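(* Let $\mathbb{K}$ be a field of characteristic zero. Let $(\mathfrak{g},B,\omega)$ be a finite-dimensional quadratic symplectic Lie superalgebra of filiform type over $\mathbb{K}$ with $\dim\mathfrak{g}_{\bar 1}=m>0$, where $\mathfrak{g}_{\bar 1}$ is a filiform $\mathfrak{g}_{\bar 0}$-module with flag $\mathfrak{g}_{\bar 1}=V_m\supset\dots\supset V_1\supset V_0$. Let $V_1=\mathbb{K}e_1$ and let $e_m\in V_m\setminus V_{m-1}$ (so $V_m=V_{m-1}\oplus\mathbb{K}e_m$). Let $\delta$ be the unique even invertible skew-supersymmetric superderivation of $(\mathfrak{g},B)$ such that $\omega(X,Y)=B(\delta(X),Y)$ for all $X,Y\in\mathfrak{g}$. Let $D$ be an odd skew-supersymmetric superderivation of $(\mathfrak{g},B)$ and $X_0$ a non-zero element of $\mathfrak{g}_{\bar 0}$ such that $$D(X_0)=0,\quad B(X_0,X_0)=0,\quad D^2=\tfrac12[X_0,\cdot]_{\mathfrak{g}},\quad\text{and}\quad e_m\in D(\mathfrak{g}_{\bar 0}).$$ Let $(\widetilde{\mathfrak{g}}=\mathbb{K}e\oplus\mathfrak{g}\oplus\mathbb{K}e^*,\widetilde{B})$ be the generalized double extension of $(\mathfrak{g},B)$ by the one-dimensional Lie superalgebra $(\mathbb{K}e)_{\bar 1}$ (by means of $D$ and $X_0$). If there exist $\alpha\in\mathbb{K}\setminus\{0\}$, $\mu\in\mathbb{K}$ and $A_1\in\mathfrak{g}_{\bar 1}$ such that $$[\delta,D]+\alpha D=\mathrm{ad}_{A_1},\qquad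 D(A_1)=\alpha X_0+\tfrac12\delta(X_0),$$ then the linear endomorphism $\widetilde{\delta}:\widetilde{\mathfrak{g}}\to\widetilde{\mathfrak{g}}$ defined by $$\widetilde{\delta}(e^* )=\alpha e^*,\qquad \widetilde{\delta}(e)=\mu e^*+A_1-\alpha e,\qquad \widetilde{\delta}(X)=\delta(X)-B(X,A_1)e^*\quad\text{for all }X\in\mathfrak{g},$$ is an even invertible skew-supersymmetric superderivation of $(\widetilde{\mathfrak{g}},\widetilde{B})$. Consequently, with $\widetilde{\omega}(X,Y):=\widetilde{B}(\widetilde{\delta}(X),Y)$ for all $X,Y\in\widetilde{\mathfrak{g}}$, $(\widetilde{\mathfrak{g}},\widetilde{B},\widetilde{\omega})$ is a quadratic symplectic Lie superalgebra of filiform type, i.e. $\widetilde{\mathfrak{g}}_{\bar 1}$ is a filiform $\widetilde{\mathfrak{g}}_{\bar 0}$-module with the flag $\widetilde{\mathfrak{g}}_{\bar 1}=\widetilde{V}_{m+2}\supset\dots\supset\widetilde{V}_1\supset\widetilde{V}_0$, where $\widetilde{V}_{m+2}=\mathbb{K}e\oplus V_m\oplus\mathbb{K}e^*$, $\widetilde{V}_i=V_{i-1}\oplus\mathbb{K}e^*$ for $1\le i\le m+1$, and $\widetilde{V}_0=\{0\}$.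
   Context: A Lie superalgebra is a $\mathbb{Z}_2$-graded vector space $\mathfrak{g}=\mathfrak{g}_{\bar 0}\oplus\mathfrak{g}_{\bar 1}$ with an even bilinear bracket satisfying, for homogeneous $X,Y,Z$ of degrees $x,y,z$, $[X,Y]=-(-1)^{xy}[Y,X]$ and $(-1)^{xz}[X,[Y,Z]]+(-1)^{xy}[Y,[Z,X]]+(-1)^{yz}[Z,[X,Y]]=0$. A bilinear form $F$ is even if $F(\mathfrak{g}_{\bar 0},\mathfrak{g}_{\bar 1})=F(\mathfrak{g}_{\bar 1},\mathfrak{g}_{\bar 0})=\{0\}$. $(\mathfrak{g},B)$ is quadratic if $B$ is an even, non-degenerate, supersymmetric ($B(X,Y)=(-1)^{xy}B(Y,X)$), invariant ($B([X,Y],Z)=B(X,[Y,Z])$) bilinear form. A symplectic structure is an even, non-degenerate, skew-supersymmetric ($\omega(X,Y)=-(-1)^{xy}\omega(Y,X)$) bilinear form with $(-1)^{xz}\omega(X,[Y,Z])+(-1)^{yx}\omega(Y,[Z,X])+(-1)^{zy}\omega(Z,[X,Y])=0$. A quadratic symplectic Lie superalgebra $(\mathfrak{g},B,\omega)$ carries both. A superderivation of degree $d$ is a linear map $D$ homogeneous of degree $d$ with $D([X,Y])=[D(X),Y]+(-1)^{dx}[X,D(Y)]$; it is skew-supersymmetric if $B(D(X),Y)=-(-1)^{dx}B(X,D(Y))$ for $X\in\mathfrak{g}_x$. The symplectic structures on a quadratic $(\mathfrak{g},B)$ are exactly the forms $B(\delta(\cdot),\cdot)$ with $\delta$ an even invertible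 skew-supersymmetric superderivation. Here $[\delta,D]=\delta D-D\delta$ ($\delta$ is even) and $\mathrm{ad}_{A_1}=[A_1,\cdot]_{\mathfrak{g}}$. Generalized double extension of $(\mathfrak{g},B)$ by $(\mathbb{K}e)_{\bar 1}$ by means of $D$ and $X_0$ (with $X_0\neq0$, $D(X_0)=0$, $B(X_0,X_0)=0$, $D^2=\frac12[X_0,\cdot]_{\mathfrak{g}}$): $\widetilde{\mathfrak{g}}=\mathbb{K}e\oplus\mathfrak{g}\oplus\mathbb{K}e^*$ with $e,e^*$ odd, brackets $[e,e]=X_0$, $[e^*,\widetilde{\mathfrak{g}}]=\{0\}$, $[e,X]=D(X)-B(X,X_0)e^*$, $[X,Y]=[X,Y]_{\mathfrak{g}}-B(D(X),Y)e^*$ for $X,Y\in\mathfrak{g}$, and supersymmetric form $\widetilde{B}|_{\mathfrak{g}\times\mathfrak{g}}=B$, $\widetilde{B}(e^*,e)=1$, $\widetilde{B}(\mathfrak{g},e)=\widetilde{B}(\mathfrak{g},e^* )=\{0\}$, $\widetilde{B}(e,e)=\widetilde{B}(e^*,e^* )=0$; this is a quadratic Lie superalgebra. A Lie superalgebra $\mathfrak{g}$ with $\dim\mathfrak{g}_{\bar 1}=m>0$ is of filiform type ($\mathfrak{g}_{\bar 1}$ is a filiform $\mathfrak{g}_{\bar 0}$-module) if there is a flag $\mathfrak{g}_{\bar 1}=V_m\supset\dots\supset V_1\supset V_0$ with $\dim V_i=i$ and $[\mathfrak{g}_{\bar 0},V_{i+1}]=V_i$ for $0\le i\le m-1$. 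*)

theory Defs
  imports Complex_Main "HOL-Library.Z2" "HOL-Library.Product_Plus"
begin

text \<open>Degrees live in the two-element field \<^typ>\<open>bit\<close>; \<open>ksign d\<close> is \<open>(-1)\<close> to the power \<open>d\<close>.\<close>

definition ksign :: "bit \<Rightarrow> 'k::field_char_0" where
  "ksign d = (if d = 0 then 1 else - 1)"

locale super_vector_space = vector_space scale
  for scale :: "'k::field_char_0 \<Rightarrow> 'v::ab_group_add \<Rightarrow> 'v" +
  fixes G :: "bit \<Rightarrow> 'v set"
  assumes subspace_G: "subspace (G d)"
    and G_inter: "G 0 \<inter> G 1 = {0}"
    and G_decomp: "\<exists>x0\<in>G 0. \<exists>x1\<in>G 1. x = x0 + x1"

definition bilinear_form :: "('k::field_char_0 \<Rightarrow> 'v::ab_group_add \<Rightarrow> 'v) \<Rightarrow> ('v \<Rightarrow> 'v \<Rightarrow> 'k) \<Rightarrow> bool" where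
  "bilinear_form scale F \<longleftrightarrow>
     (\<forall>x. Vector_Spaces.linear scale (*) (\<lambda>y. F x y)) \<and>
     (\<forall>y. Vector_Spaces.linear scale (*) (\<lambda>x. F x y))"

definition even_form :: "(bit \<Rightarrow> 'v set) \<Rightarrow> ('v \<Rightarrow> 'v \<Rightarrow> 'k::field_char_0) \<Rightarrow> bool" where
  "even_form G F \<longleftrightarrow> (\<forall>x\<in>G 0. \<forall>y\<in>G 1. F x y = 0 \<and> F y x = 0)"

definition nondegenerate_form :: "('v::ab_group_add \<Rightarrow> 'v \<Rightarrow> 'k::field_char_0) \<Rightarrow> bool" where
  "nondegenerate_form F \<longleftrightarrow>
     (\<forall>x. (\<forall>y. F x y = 0) \<longrightarrow> x = 0) \<and> (\<forall>y. (\<forall>x. F x y = 0) \<longrightarrow> y = 0)"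

definition supersymmetric_form :: "(bit \<Rightarrow> 'v set) \<Rightarrow> ('v \<Rightarrow> 'v \<Rightarrow> 'k::field_char_0) \<Rightarrow> bool" where
  "supersymmetric_form G F \<longleftrightarrow>
     (\<forall>a b. \<forall>x\<in>G a. \<forall>y\<in>G b. F x y = ksign (a * b) * F y x)"

definition skew_supersymmetric_form :: "(bit \<Rightarrow> 'v set) \<Rightarrow> ('v \<Rightarrow> 'v \<Rightarrow> 'k::field_char_0) \<Rightarrow> bool" where
  "skew_supersymmetric_form G F \<longleftrightarrow>
     (\<forall>a b. \<forall>x\<in>G a. \<forall>y\<in>G b. F x y = - ksign (a * b) * F y x)"

locale lie_superalgebra = super_vector_space scale G
  for scale :: "'k::field_char_0 \<Rightarrow> 'v::ab_group_add \<Rightarrow> 'v" and G :: "bit \<Rightarrow> 'v set" +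
  fixes br :: "'v \<Rightarrow> 'v \<Rightarrow> 'v"
  assumes br_linear_right: "Vector_Spaces.linear scale scale (\<lambda>y. br x y)"
    and br_linear_left: "Vector_Spaces.linear scale scale (\<lambda>x. br x y)"
    and br_even: "\<lbrakk>x \<in> G a; y \<in> G b\<rbrakk> \<Longrightarrow> br x y \<in> G (a + b)"
    and br_skew: "\<lbrakk>x \<in> G a; y \<in> G b\<rbrakk> \<Longrightarrow> br x y = - scale (ksign (a * b)) (br y x)"
    and br_jacobi: "\<lbrakk>x \<in> G a; y \<in> G b; z \<in> G c\<rbrakk> \<Longrightarrow>
      scale (ksign (a * c)) (br x (br y z)) + scale (ksign (a * b)) (br y (br z x))
        + scale (ksign (b * c)) (br z (br x y)) = 0"

locale quadratic_lie_superalgebra = lie_superalgebra scale G br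
  for scale :: "'k::field_char_0 \<Rightarrow> 'v::ab_group_add \<Rightarrow> 'v" and G :: "bit \<Rightarrow> 'v set"
    and br :: "'v \<Rightarrow> 'v \<Rightarrow> 'v" +
  fixes B :: "'v \<Rightarrow> 'v \<Rightarrow> 'k"
  assumes B_bilinear: "bilinear_form scale B"
    and B_even: "even_form G B"
    and B_nondegenerate: "nondegenerate_form B"
    and B_supersymmetric: "supersymmetric_form G B"
    and B_invariant: "B (br x y) z = B x (br y z)"

locale quadratic_symplectic_lie_superalgebra = quadratic_lie_superalgebra scale G br B
  for scale :: "'k::field_char_0 \<Rightarrow> 'v::ab_group_add \<Rightarrow> 'v" and G :: "bit \<Rightarrow> 'v set"
    and br :: "'v \<Rightarrow> 'v \<Rightarrow> 'v" and B :: "'v \<Rightarrow> 'v \<Rightarrow> 'k" +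
  fixes \<omega> :: "'v \<Rightarrow> 'v \<Rightarrow> 'k"
  assumes \<omega>_bilinear: "bilinear_form scale \<omega>"
    and \<omega>_even: "even_form G \<omega>"
    and \<omega>_nondegenerate: "nondegenerate_form \<omega>"
    and \<omega>_skew: "skew_supersymmetric_form G \<omega>"
    and \<omega>_closed: "\<lbrakk>x \<in> G a; y \<in> G b; z \<in> G c\<rbrakk> \<Longrightarrow>
      ksign (a * c) * \<omega> x (br y z) + ksign (b * a) * \<omega> y (br z x)
        + ksign (c * b) * \<omega> z (br x y) = 0"

definition superderivation ::
  "('k::field_char_0 \<Rightarrow> 'v::ab_group_add \<Rightarrow> 'v) \<Rightarrow> (bit \<Rightarrow> 'v set) \<Rightarrow> ('v \<Rightarrow> 'v \<Rightarrow> 'v) \<Rightarrow>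
     bit \<Rightarrow> ('v \<Rightarrow> 'v) \<Rightarrow> bool" where
  "superderivation scale G br d D \<longleftrightarrow>
     Vector_Spaces.linear scale scale D \<and>
     (\<forall>a. \<forall>x\<in>G a. D x \<in> G (a + d)) \<and>
     (\<forall>a. \<forall>x\<in>G a. \<forall>y. D (br x y) = br (D x) y + scale (ksign (d * a)) (br x (D y)))"

definition skew_supersymmetric_map ::
  "(bit \<Rightarrow> 'v set) \<Rightarrow> ('v \<Rightarrow> 'v \<Rightarrow> 'k::field_char_0) \<Rightarrow> bit \<Rightarrow> ('v \<Rightarrow> 'v) \<Rightarrow> bool" where
  "skew_supersymmetric_map G B d D \<longleftrightarrow>
     (\<forall>a. \<forall>x\<in>G a. \<forall>y. B (D x) y = - ksign (d * a) * B x (D y))"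

text \<open>\<open>V 0, \<dots>, V m\<close> is a flag exhibiting \<open>G 1\<close> as a filiform \<open>G 0\<close>-module;
  the bracket of two subspaces is the span of the brackets of their elements.
  Values \<open>V i\<close> with \<open>i > m\<close> are irrelevant.\<close>

locale filiform_lie_superalgebra = lie_superalgebra scale G br
  for scale :: "'k::field_char_0 \<Rightarrow> 'v::ab_group_add \<Rightarrow> 'v" and G :: "bit \<Rightarrow> 'v set"
    and br :: "'v \<Rightarrow> 'v \<Rightarrow> 'v" +
  fixes m :: nat and V :: "nat \<Rightarrow> 'v set"
  assumes dim_odd: "dim (G 1) = m" and m_pos: "m > 0"
    and V_top: "V m = G 1"
    and V_subspace: "i \<le> m \<Longrightarrow> subspace (V i)"
    and V_dim: "i \<le> m \<Longrightarrow> dim (V i) = i"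
    and V_mono: "i < m \<Longrightarrow> V i \<subseteq> V (Suc i)"
    and V_bracket: "i < m \<Longrightarrow> span {br x v | x v. x \<in> G 0 \<and> v \<in> V (Suc i)} = V i"

text \<open>The generalized double extension lives on \<^typ>\<open>'k \<times> 'v \<times> 'k\<close>, where \<open>(a, x, b)\<close>
  stands for \<open>a e + x + b e\<^sup>*\<close>, with \<open>e\<close> and \<open>e\<^sup>*\<close> odd.\<close>

definition ext_scale :: "('k::field_char_0 \<Rightarrow> 'v \<Rightarrow> 'v) \<Rightarrow> 'k \<Rightarrow> 'k \<times> 'v \<times> 'k \<Rightarrow> 'k \<times> 'v \<times> 'k" where
  "ext_scale scale c = (\<lambda>(a, x, b). (c * a, scale c x, c * b))"

definition ext_grading :: "(bit \<Rightarrow> 'v set) \<Rightarrow> bit \<Rightarrow> ('k::field_char_0 \<times> 'v \<times> 'k) set" where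
  "ext_grading G d = (if d = 0 then {(0, x, 0) | x. x \<in> G 0} else {(a, x, b) | a x b. x \<in> G 1})"

definition parity_inv :: "(bit \<Rightarrow> 'v::ab_group_add set) \<Rightarrow> 'v \<Rightarrow> 'v" where
  "parity_inv G x = (THE y. \<exists>x0\<in>G 0. \<exists>x1\<in>G 1. x = x0 + x1 \<and> y = x0 - x1)"

text \<open>The brackets \<open>[x, e] = - (-1)\<^sup>d [e, x]\<close> for \<open>x\<close> of degree \<open>d\<close>, forced by super
  skew-symmetry, extend linearly to \<open>[x, e] = - [e, parity_inv G x]\<close>. The lemmas below evaluate the
  bracket on the generators.\<close>

definition ext_bracket ::
  "('k::field_char_0 \<Rightarrow> 'v::ab_group_add \<Rightarrow> 'v) \<Rightarrow> (bit \<Rightarrow> 'v set) \<Rightarrow> ('v \<Rightarrow> 'v \<Rightarrow> 'v) \<Rightarrow>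
     ('v \<Rightarrow> 'v \<Rightarrow> 'k) \<Rightarrow> ('v \<Rightarrow> 'v) \<Rightarrow> 'v \<Rightarrow> 'k \<times> 'v \<times> 'k \<Rightarrow> 'k \<times> 'v \<times> 'k \<Rightarrow> 'k \<times> 'v \<times> 'k" where
  "ext_bracket scale G br B D X0 = (\<lambda>(a, x, b) (a', x', b').
     (0,
      scale (a * a') X0 + scale a (D x') - scale a' (D (parity_inv G x)) + br x x',
      - (a * B x' X0) + a' * B (parity_inv G x) X0 - B (D x) x'))"

definition ext_form :: "('v \<Rightarrow> 'v \<Rightarrow> 'k::field_char_0) \<Rightarrow> 'k \<times> 'v \<times> 'k \<Rightarrow> 'k \<times> 'v \<times> 'k \<Rightarrow> 'k" where
  "ext_form B = (\<lambda>(a, x, b) (a', x', b'). B x x' + b * a' - a * b')"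

definition ext_map ::
  "('k::field_char_0 \<Rightarrow> 'v::ab_group_add \<Rightarrow> 'v) \<Rightarrow> ('v \<Rightarrow> 'v \<Rightarrow> 'k) \<Rightarrow> ('v \<Rightarrow> 'v) \<Rightarrow> 'k \<Rightarrow> 'k \<Rightarrow> 'v \<Rightarrow>
     'k \<times> 'v \<times> 'k \<Rightarrow> 'k \<times> 'v \<times> 'k" where
  "ext_map scale B \<delta> \<alpha> \<mu> A1 =
     (\<lambda>(a, x, b). (- (\<alpha> * a), scale a A1 + \<delta> x, \<mu> * a - B x A1 + \<alpha> * b))"

definition ext_flag :: "nat \<Rightarrow> (nat \<Rightarrow> 'v set) \<Rightarrow> nat \<Rightarrow> ('k::field_char_0 \<times> 'v::ab_group_add \<times> 'k) set" where
  "ext_flag m V i =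
     (if i = 0 then {0}
      else if i \<le> m + 1 then {(0, x, b) | x b. x \<in> V (i - 1)}
      else {(a, x, b) | a x b. x \<in> V m})"

context super_vector_space
begin

lemma parity_inv_eq:
  assumes "x0 \<in> G 0" "x1 \<in> G 1"
  shows "parity_inv G (x0 + x1) = x0 - x1"
  unfolding parity_inv_def
proof (rule the_equality)
  show "\<exists>y0\<in>G 0. \<exists>y1\<in>G 1. x0 + x1 = y0 + y1 \<and> x0 - x1 = y0 - y1"
    using assms by blast
next
  fix y assume "\<exists>y0\<in>G 0. \<exists>y1\<in>G 1. x0 + x1 = y0 + y1 \<and> y = y0 - y1"
  then obtain y0 y1 where y: "y0 \<in> G 0" "y1 \<in> G 1" "x0 + x1 = y0 + y1" "y = y0 - y1"
    by blast
  have eq: "x0 - y0 = y1 - x1" using y(3) by (simp add: algebra_simps)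
  have "x0 - y0 \<in> G 0" "y1 - x1 \<in> G 1"
    using assms y subspace_G by (auto intro: subspace_diff)
  then have "x0 - y0 \<in> G 0 \<inter> G 1" using eq by simp
  then have "x0 = y0" "x1 = y1" using G_inter eq by auto
  then show "y = x0 - x1" using y by simp
qed

lemma parity_inv_homogeneous:
  assumes "x \<in> G d"
  shows "parity_inv G x = scale (ksign d) x"
proof (cases d)
  case zero
  then show ?thesis
    using parity_inv_eq[of x 0] assms subspace_G[of 1] by (simp add: ksign_def subspace_0)
next
  case one
  then show ?thesis
    using parity_inv_eq[of 0 x] assms subspace_G[of 0] by (simp add: ksign_def subspace_0)
qed

lemma parity_inv_0: "parity_inv G 0 = 0"
  using parity_inv_homogeneous[of 0 0] subspace_G[of 0] by (simp add: subspace_0)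

end

context quadratic_lie_superalgebra
begin

lemma ext_bracket_generators:
  fixes X0 x y :: 'v and u :: "'k \<times> 'v \<times> 'k"
  assumes D: "Vector_Spaces.linear scale scale D"
  defines "e \<equiv> (1, 0, 0)" and "es \<equiv> (0, 0, 1)"
  defines "br' \<equiv> ext_bracket scale G br B D X0"
  shows "br' e e = (0, X0, 0)"
    and "br' es u = 0" and "br' u es = 0"
    and "br' e (0, x, 0) = (0, D x, - B x X0)"
    and "x \<in> G d \<Longrightarrow> br' (0, x, 0) e = - ext_scale scale (ksign d) (br' e (0, x, 0))"
    and "br' (0, x, 0) (0, y, 0) = (0, br x y, - B (D x) y)"
proof -
  interpret D: Vector_Spaces.linear scale scale D by (rule D)
  have B0: "B 0 y = 0" "B y 0 = 0" and Bs: "B (scale c x) y = c * B x y" for x y c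
  proof -
    interpret l: Vector_Spaces.linear scale "(*)" "\<lambda>x. B x y"
      using B_bilinear by (simp add: bilinear_form_def)
    interpret r: Vector_Spaces.linear scale "(*)" "\<lambda>x. B y x"
      using B_bilinear by (simp add: bilinear_form_def)
    show "B 0 y = 0" "B y 0 = 0" "B (scale c x) y = c * B x y"
      using l.zero r.zero l.scale by auto
  qed
  have br0: "br 0 y = 0" "br y 0 = 0" for y
  proof -
    interpret l: Vector_Spaces.linear scale scale "\<lambda>x. br x y" by (rule br_linear_left)
    interpret r: Vector_Spaces.linear scale scale "\<lambda>x. br y x" by (rule br_linear_right)
    show "br 0 y = 0" "br y 0 = 0" using l.zero r.zero by auto
  qed
  note simps = br'_def e_def es_def ext_bracket_def ext_scale_def parity_inv_0 D.zero B0 br0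
  show "br' e e = (0, X0, 0)" "br' es u = 0" "br' u es = 0"
    "br' e (0, x, 0) = (0, D x, - B x X0)"
    "br' (0, x, 0) (0, y, 0) = (0, br x y, - B (D x) y)"
    by (auto simp: simps zero_prod_def split: prod.splits)
  show "br' (0, x, 0) e = - ext_scale scale (ksign d) (br' e (0, x, 0))" if "x \<in> G d"
    using that by (simp add: simps parity_inv_homogeneous D.scale Bs)
qed

lemma ext_map_generators:
  assumes \<delta>: "Vector_Spaces.linear scale scale \<delta>"
  shows "ext_map scale B \<delta> \<alpha> \<mu> A1 (0, 0, 1) = ext_scale scale \<alpha> (0, 0, 1)"
    and "ext_map scale B \<delta> \<alpha> \<mu> A1 (1, 0, 0)
      = ext_scale scale \<mu> (0, 0, 1) + (0, A1, 0) - ext_scale scale \<alpha> (1, 0, 0)"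
    and "ext_map scale B \<delta> \<alpha> \<mu> A1 (0, x, 0)
      = (0, \<delta> x, 0) - ext_scale scale (B x A1) (0, 0, 1)"
proof -
  interpret \<delta>: Vector_Spaces.linear scale scale \<delta> by (rule \<delta>)
  interpret l: Vector_Spaces.linear scale "(*)" "\<lambda>x. B x A1"
    using B_bilinear by (simp add: bilinear_form_def)
  show "ext_map scale B \<delta> \<alpha> \<mu> A1 (0, 0, 1) = ext_scale scale \<alpha> (0, 0, 1)"
    "ext_map scale B \<delta> \<alpha> \<mu> A1 (1, 0, 0)
      = ext_scale scale \<mu> (0, 0, 1) + (0, A1, 0) - ext_scale scale \<alpha> (1, 0, 0)"
    "ext_map scale B \<delta> \<alpha> \<mu> A1 (0, x, 0)
      = (0, \<delta> x, 0) - ext_scale scale (B x A1) (0, 0, 1)"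
    using l.zero by (auto simp: ext_map_def ext_scale_def \<delta>.zero)
qed

end

end

(* Super Jacobi for the double extension need only be checked for one ordering of each of the four
   parity patterns, since it is cyclically invariant; D^2 = (1/2)[X0, .] makes the cross terms
   cancel. The two hypotheses on A1 are exactly what the derivation rule for the extended map
   demands on the brackets [e, X] and [e, e]. An even invertible skew-supersymmetric
   superderivation d of a quadratic Lie superalgebra always gives the symplectic form B(d x, y).

   For the flag, the only question is whether the e*-direction and all of V_m are reached. The line
   V_1 is orthogonal to V_{m-1} = [g_0, V_m] by invariance, so nondegeneracy of B forces
   B(e_m, e_1) to be nonzero; writing e_m = D g with g even, [g, e_1] is a nonzero multiple of e*
   in the extension, and [g, e] supplies e_m. *)
theory Submission
  imports Defs "HOL-Analysis.Product_Vector"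
begin

section \<open>Arithmetic of signs and degrees\<close>

lemma ksign_simps [simp]: "ksign 0 = 1" "ksign 1 = - 1"
  by (simp_all add: ksign_def)

text \<open>Collected for \<open>simp only\<close> calls in which the exponents of the signs have to
  be evaluated.\<close>

lemma bit_arith: "0 + (d::bit) = d" "d + 0 = d" "(1::bit) + 1 = 0" "0 * d = 0" "d * 0 = 0"
    "(1::bit) * 1 = 1"
  by simp_all

lemma bit_01_cases: "(d::bit) = 0 \<or> d = 1"
  by (cases d) auto

text \<open>Needed for the super Jacobi identity on three odd elements, where all three signs are
  -1.\<close>

lemma minus_sum3:
  fixes x y z :: "'a::ab_group_add"
  assumes "x + y + z = 0"
  shows "- x + - y + - z = 0"
  using arg_cong[OF assms, of uminus] by (simp add: algebra_simps)

section \<open>Invariant forms and symplectic structures\<close>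

context super_vector_space
begin

lemma homogeneous_decomp:
  obtains x0 x1 where "x0 \<in> G 0" "x1 \<in> G 1" "x = x0 + x1"
  using G_decomp[of x] by blast

lemma parity_inv_even [simp]: "x \<in> G 0 \<Longrightarrow> parity_inv G x = x"
  and parity_inv_odd [simp]: "x \<in> G 1 \<Longrightarrow> parity_inv G x = - x"
  using parity_inv_homogeneous[of x 0] parity_inv_homogeneous[of x 1] by simp_all

text \<open>As \<open>parity_inv\<close> is given by a definite description, its linearity is read
  off from decompositions into homogeneous parts.\<close>

lemma parity_inv_add: "parity_inv G (x + y) = parity_inv G x + parity_inv G y"
proof -
  obtain x0 x1 y0 y1 where h: "x0 \<in> G 0" "x1 \<in> G 1" "x = x0 + x1"
      "y0 \<in> G 0" "y1 \<in> G 1" "y = y0 + y1"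
    using homogeneous_decomp[of x] homogeneous_decomp[of y] by metis
  have "x + y = (x0 + y0) + (x1 + y1)"
    using h by simp
  also have "parity_inv G \<dots> = (x0 + y0) - (x1 + y1)"
    using h subspace_G[THEN subspace_add] by (intro parity_inv_eq) auto
  also have "\<dots> = parity_inv G x + parity_inv G y"
    using h by (simp add: parity_inv_eq)
  finally show ?thesis .
qed

lemma parity_inv_scale: "parity_inv G (scale c x) = scale c (parity_inv G x)"
proof -
  obtain x0 x1 where h: "x0 \<in> G 0" "x1 \<in> G 1" "x = x0 + x1"
    using homogeneous_decomp[of x] .
  then show ?thesis
    using parity_inv_eq[of "scale c x0" "scale c x1"] parity_inv_eq[of x0 x1]
      subspace_G[THEN subspace_scale] by (simp add: scale_right_distrib scale_right_diff_distrib)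
qed

lemma parity_inv_diff: "parity_inv G (x - y) = parity_inv G x - parity_inv G y"
  using parity_inv_add[of "x - y" y] by (simp add: algebra_simps)

lemma parity_inv_involutive: "parity_inv G (parity_inv G x) = x"
proof -
  obtain x0 x1 where h: "x0 \<in> G 0" "x1 \<in> G 1" "x = x0 + x1"
    using homogeneous_decomp[of x] .
  then show ?thesis
    using parity_inv_eq[of x0 "- x1"] subspace_G[THEN subspace_neg] by (simp add: parity_inv_eq)
qed

lemmas G_closed = subspace_G[THEN subspace_0] subspace_G[THEN subspace_add]
  subspace_G[THEN subspace_diff] subspace_G[THEN subspace_neg] subspace_G[THEN subspace_scale]

end

section \<open>Bracket rules for elements of known parity\<close>

context lie_superalgebra
begin

lemma br_degree:
  "x \<in> G 0 \<Longrightarrow> y \<in> G 0 \<Longrightarrow> br x y \<in> G 0" "x \<in> G 0 \<Longrightarrow> y \<in> G 1 \<Longrightarrow> br x y \<in> G 1"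
  "x \<in> G 1 \<Longrightarrow> y \<in> G 0 \<Longrightarrow> br x y \<in> G 1" "x \<in> G 1 \<Longrightarrow> y \<in> G 1 \<Longrightarrow> br x y \<in> G 0"
  using br_even[of x 0 y 0] br_even[of x 0 y 1] br_even[of x 1 y 0] br_even[of x 1 y 1] by simp_all

lemma br_bilinear:
  "br (x + y) z = br x z + br y z" "br z (x + y) = br z x + br z y"
  "br (x - y) z = br x z - br y z" "br z (x - y) = br z x - br z y"
  "br (- x) z = - br x z" "br z (- x) = - br z x"
  "br (scale c x) z = scale c (br x z)" "br z (scale c x) = scale c (br z x)"
  "br 0 z = 0" "br z 0 = 0"
proof -
  interpret l: Vector_Spaces.linear scale scale "\<lambda>x. br x z" by (rule br_linear_left)
  interpret r: Vector_Spaces.linear scale scale "\<lambda>x. br z x" by (rule br_linear_right)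
  show "br (x + y) z = br x z + br y z" "br z (x + y) = br z x + br z y"
    "br (x - y) z = br x z - br y z" "br z (x - y) = br z x - br z y"
    "br (- x) z = - br x z" "br z (- x) = - br z x"
    "br (scale c x) z = scale c (br x z)" "br z (scale c x) = scale c (br z x)"
    "br 0 z = 0" "br z 0 = 0"
    using l.add r.add l.diff r.diff l.neg r.neg l.scale r.scale l.zero r.zero by blast+
qed

text \<open>In degree 0 the Leibniz sign is 1 for both parities, so the rule extends additively to
  inhomogeneous \<open>x\<close>.\<close>

lemma superderivation_even:
  assumes D: "superderivation scale G br 0 D"
  shows "D (br x y) = br (D x) y + br x (D y)"
proof -
  interpret D: Vector_Spaces.linear scale scale D
    using D unfolding superderivation_def by blast
  have "D (br z y) = br (D z) y + br z (D y)" if "z \<in> G a" for z a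
  proof -
    have "D (br z y) = br (D z) y + scale (ksign (0 * a)) (br z (D y))"
      using D that unfolding superderivation_def by blast
    then show ?thesis by simp
  qed
  moreover obtain x0 x1 where "x0 \<in> G 0" "x1 \<in> G 1" "x = x0 + x1"
    using homogeneous_decomp[of x] .
  ultimately show ?thesis
    by (simp add: br_bilinear D.add algebra_simps)
qed

text \<open>An even \<open>x\<close> has sign 1 against both parts of \<open>y\<close>, which may
  therefore be inhomogeneous.\<close>

lemma br_commute_even:
  assumes "x \<in> G 0" shows "br x y = - br y x"
proof -
  obtain y0 y1 where y: "y0 \<in> G 0" "y1 \<in> G 1" "y = y0 + y1"
    using homogeneous_decomp[of y] .
  show ?thesis
    using br_skew[OF assms y(1)] br_skew[OF assms y(2)] by (simp add: y(3) br_bilinear)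
qed

lemma br_commute_odd: "x \<in> G 1 \<Longrightarrow> y \<in> G 1 \<Longrightarrow> br x y = br y x"
  using br_skew[of x 1 y 1] by simp

end

section \<open>Invariant forms and skew-supersymmetric maps\<close>

context quadratic_lie_superalgebra
begin

lemma B_bilinear_simps:
  "B (x + y) z = B x z + B y z" "B z (x + y) = B z x + B z y"
  "B (x - y) z = B x z - B y z" "B z (x - y) = B z x - B z y"
  "B (- x) z = - B x z" "B z (- x) = - B z x"
  "B (scale c x) z = c * B x z" "B z (scale c x) = c * B z x"
  "B 0 z = 0" "B z 0 = 0"
proof -
  interpret l: Vector_Spaces.linear scale "(*)" "\<lambda>x. B x z"
    using B_bilinear by (simp add: bilinear_form_def)
  interpret r: Vector_Spaces.linear scale "(*)" "\<lambda>x. B z x"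
    using B_bilinear by (simp add: bilinear_form_def)
  show "B (x + y) z = B x z + B y z" "B z (x + y) = B z x + B z y"
    "B (x - y) z = B x z - B y z" "B z (x - y) = B z x - B z y"
    "B (- x) z = - B x z" "B z (- x) = - B z x"
    "B (scale c x) z = c * B x z" "B z (scale c x) = c * B z x"
    "B 0 z = 0" "B z 0 = 0"
    using l.add r.add l.diff r.diff l.neg r.neg l.scale r.scale l.zero r.zero by blast+
qed

lemma B_orthogonal: "\<lbrakk>x \<in> G a; y \<in> G b; a \<noteq> b\<rbrakk> \<Longrightarrow> B x y = 0"
  using B_even bit_01_cases[of a] bit_01_cases[of b] unfolding even_form_def by auto

lemma B_commute: "\<lbrakk>x \<in> G a; y \<in> G b\<rbrakk> \<Longrightarrow> B x y = ksign (a * b) * B y x"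
  using B_supersymmetric unfolding supersymmetric_form_def by blast

lemma B_commute_even: "x \<in> G 0 \<Longrightarrow> B x y = B y x"
proof -
  assume x: "x \<in> G 0"
  obtain y0 y1 where y: "y0 \<in> G 0" "y1 \<in> G 1" "y = y0 + y1"
    using homogeneous_decomp[of y] .
  show ?thesis
    using x y B_commute[of x 0 y0 0] B_commute[of x 0 y1 1] by (simp add: B_bilinear_simps)
qed

text \<open>The even part of \<open>y\<close> is orthogonal to \<open>x\<close>, so only the odd
  part, with its sign -1, contributes.\<close>

lemma B_commute_odd: "x \<in> G 1 \<Longrightarrow> B x y = - B y x"
proof -
  assume x: "x \<in> G 1"
  obtain y0 y1 where y: "y0 \<in> G 0" "y1 \<in> G 1" "y = y0 + y1"
    using homogeneous_decomp[of y] .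
  show ?thesis
    using x y B_orthogonal[of x 1 y0 0] B_orthogonal[of y0 0 x 1] B_commute[of x 1 y1 1]
    by (simp add: B_bilinear_simps)
qed

text \<open>By orthogonality of the two parities both sides are
  \<open>B x0 y0 - B x1 y1\<close>.\<close>

lemma B_parity_inv: "B (parity_inv G x) y = B x (parity_inv G y)"
proof -
  obtain x0 x1 y0 y1 where h: "x0 \<in> G 0" "x1 \<in> G 1" "x = x0 + x1"
      "y0 \<in> G 0" "y1 \<in> G 1" "y = y0 + y1"
    using homogeneous_decomp[of x] homogeneous_decomp[of y] by metis
  then show ?thesis
    using B_orthogonal[of x0 0 y1 1] B_orthogonal[of x1 1 y0 0]
    by (simp add: parity_inv_eq B_bilinear_simps)
qed

lemma skew_map_even:
  assumes lin: "Vector_Spaces.linear scale scale D" and skew: "skew_supersymmetric_map G B 0 D"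
  shows "B (D x) y = - B x (D y)"
proof -
  interpret D: Vector_Spaces.linear scale scale D by (rule lin)
  have "B (D z) y = - B z (D y)" if "z \<in> G a" for z a
  proof -
    have "B (D z) y = - ksign (0 * a) * B z (D y)"
      using skew that unfolding skew_supersymmetric_map_def by blast
    then show ?thesis by simp
  qed
  moreover obtain x0 x1 where "x0 \<in> G 0" "x1 \<in> G 1" "x = x0 + x1"
    using homogeneous_decomp[of x] .
  ultimately show ?thesis
    by (simp add: D.add B_bilinear_simps)
qed

text \<open>For even \<open>D\<close> this is closedness of \<open>B (D x) y\<close>; for the odd \<open>D\<close> of a double extension
  it is the \<open>e\<^sup>*\<close>-component of the super Jacobi identity.\<close>

lemma skew_superderivation_cyclic:
  assumes D: "superderivation scale G br d D" and skew: "skew_supersymmetric_map G B d D"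
    and x: "x \<in> G a" and y: "y \<in> G b" and z: "z \<in> G c"
  shows "ksign (a * c) * B (D x) (br y z) + ksign (a * b) * B (D y) (br z x)
    + ksign (b * c) * B (D z) (br x y) = 0"
proof -
  have deg: "D y \<in> G (b + d)" "D z \<in> G (c + d)"
    using D y z unfolding superderivation_def by blast+
  \<comment> \<open>Skewness moves \<open>D\<close> off \<open>x\<close>, the Leibniz rule splits
    the result, and invariance with the symmetries of \<open>B\<close> and \<open>br\<close> brings
    both terms to the shape they have in the cyclic sum.\<close>
  have "B (D x) (br y z) = - ksign (d * a) * B x (D (br y z))"
    using skew x unfolding skew_supersymmetric_map_def by blast
  also have "D (br y z) = br (D y) z + scale (ksign (d * b)) (br y (D z))"
    using D y unfolding superderivation_def by blast
  also have "B x \<dots> = B x (br (D y) z) + ksign (d * b) * B x (br y (D z))"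
    by (simp add: B_bilinear_simps)
  also have "B x (br y (D z)) = B (br x y) (D z)"
    by (simp add: B_invariant)
  also have "\<dots> = ksign ((a + b) * (c + d)) * B (D z) (br x y)"
    using B_commute br_even deg x y by blast
  also have "B x (br (D y) z) = - ksign ((b + d) * c) * B x (br z (D y))"
    using br_skew[OF deg(1) z] by (simp add: B_bilinear_simps)
  also have "B x (br z (D y)) = B (br x z) (D y)"
    by (simp add: B_invariant)
  also have "\<dots> = - ksign (a * c) * B (br z x) (D y)"
    using br_skew[OF x z] by (simp add: B_bilinear_simps)
  also have "B (br z x) (D y) = ksign ((c + a) * (b + d)) * B (D y) (br z x)"
    using B_commute br_even deg x z by blast
  finally have eq: "B (D x) (br y z) =
      - ksign (d * a) * (- ksign ((b + d) * c) * (- ksign (a * c) *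
          (ksign ((c + a) * (b + d)) * B (D y) (br z x)))
        + ksign (d * b) * (ksign ((a + b) * (c + d)) * B (D z) (br x y)))" .
  \<comment> \<open>Only signs remain to be compared, in each of the sixteen parity patterns of
    \<open>a\<close>, \<open>b\<close>, \<open>c\<close>, \<open>d\<close>.\<close>
  show ?thesis
    unfolding eq
    by (cases a; cases b; cases c; cases d;
        simp only: ksign_simps bit_arith mult_minus_left mult_minus_right mult_1_left minus_minus; simp)
qed

text \<open>Bijectivity of \<open>D\<close> carries non-degeneracy over from \<open>B\<close>;
  skewness of \<open>D\<close> with supersymmetry of \<open>B\<close> gives skew-supersymmetry;
  closedness is the case \<open>d = 0\<close> of \<open>skew_superderivation_cyclic\<close>.\<close>

theorem superderivation_symplectic:
  assumes D: "superderivation scale G br 0 D" and skew: "skew_supersymmetric_map G B 0 D"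
    and bij: "bij D"
  shows "quadratic_symplectic_lie_superalgebra scale G br B (\<lambda>x y. B (D x) y)"
proof unfold_locales
  interpret D: Vector_Spaces.linear scale scale D
    using D unfolding superderivation_def by blast
  have deg: "x \<in> G a \<Longrightarrow> D x \<in> G a" for x a
    using D unfolding superderivation_def by (metis add.right_neutral)
  show "bilinear_form scale (\<lambda>x y. B (D x) y)"
    using B_bilinear unfolding bilinear_form_def
    by (auto intro!: Vector_Spaces.linear_compose[unfolded comp_def, OF D.linear_axioms])
  show "even_form G (\<lambda>x y. B (D x) y)"
    using B_even deg unfolding even_form_def by blast
  show "nondegenerate_form (\<lambda>x y. B (D x) y)"
    using B_nondegenerate bij unfolding nondegenerate_form_def
    by (metis D.zero bij_pointE)
  show "skew_supersymmetric_form G (\<lambda>x y. B (D x) y)"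
    unfolding skew_supersymmetric_form_def
  proof (intro allI ballI)
    fix a b x y assume xy: "x \<in> G a" "y \<in> G b"
    then have "B (D x) y = - B x (D y)"
      using skew unfolding skew_supersymmetric_map_def by fastforce
    then show "B (D x) y = - ksign (a * b) * B (D y) x"
      using B_commute[OF xy(1) deg[OF xy(2)]] by simp
  qed
  show "ksign (a * c) * B (D x) (br y z) + ksign (b * a) * B (D y) (br z x)
      + ksign (c * b) * B (D z) (br x y) = 0" if "x \<in> G a" "y \<in> G b" "z \<in> G c" for a b c x y z
    using skew_superderivation_cyclic[OF D skew that]
    unfolding mult.commute[of b a] mult.commute[of c b] .
qed

end

section \<open>The double extension is quadratic\<close>

locale double_extension = quadratic_lie_superalgebra scale G br B
  for scale :: "'k::field_char_0 \<Rightarrow> 'v::ab_group_add \<Rightarrow> 'v" and G :: "bit \<Rightarrow> 'v set"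
    and br :: "'v \<Rightarrow> 'v \<Rightarrow> 'v" and B :: "'v \<Rightarrow> 'v \<Rightarrow> 'k" +
  fixes D :: "'v \<Rightarrow> 'v" and X0 :: 'v
  assumes D_superderivation: "superderivation scale G br 1 D"
    and D_skew: "skew_supersymmetric_map G B 1 D"
    and X0_even: "X0 \<in> G 0" and D_X0: "D X0 = 0" and B_X0_X0: "B X0 X0 = 0"
    and D_D: "D (D x) = scale (1/2) (br X0 x)"
begin

sublocale D: Vector_Spaces.linear scale scale D
  using D_superderivation unfolding superderivation_def by blast

abbreviation "P \<equiv> parity_inv G"

lemma D_degree: "x \<in> G 0 \<Longrightarrow> D x \<in> G 1" "x \<in> G 1 \<Longrightarrow> D x \<in> G 0"
  using D_superderivation unfolding superderivation_def by (metis add_0 bit_2_eq_0 one_add_one)+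

lemma D_br: "x \<in> G 0 \<Longrightarrow> D (br x y) = br (D x) y + br x (D y)"
  "x \<in> G 1 \<Longrightarrow> D (br x y) = br (D x) y - br x (D y)"
proof -
  have "x \<in> G a \<Longrightarrow> D (br x y) = br (D x) y + scale (ksign (1 * a)) (br x (D y))" for a
    using D_superderivation unfolding superderivation_def by blast
  from this[of 0] this[of 1]
  show "x \<in> G 0 \<Longrightarrow> D (br x y) = br (D x) y + br x (D y)"
    "x \<in> G 1 \<Longrightarrow> D (br x y) = br (D x) y - br x (D y)"
    by simp_all
qed

lemma B_D: "x \<in> G 0 \<Longrightarrow> B (D x) y = - B x (D y)"
  "x \<in> G 1 \<Longrightarrow> B (D x) y = B x (D y)"
proof -
  have "x \<in> G a \<Longrightarrow> B (D x) y = - ksign (1 * a) * B x (D y)" for a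
    using D_skew unfolding skew_supersymmetric_map_def by blast
  from this[of 0] this[of 1]
  show "x \<in> G 0 \<Longrightarrow> B (D x) y = - B x (D y)" "x \<in> G 1 \<Longrightarrow> B (D x) y = B x (D y)"
    by simp_all
qed

text \<open>The sign from moving \<open>D\<close> cancels the one from exchanging two odd arguments.
  This is the \<open>e\<^sup>*\<close>-coefficient of skew-symmetry of the extended bracket in mixed
  parity.\<close>

lemma B_D_commute: "x \<in> G 0 \<Longrightarrow> y \<in> G 1 \<Longrightarrow> B x (D y) = B y (D x)"
  using B_D(1)[of x y] B_commute_odd[OF D_degree(1), of x y] by simp

lemma D_parity_inv: "D (P x) = - P (D x)"
proof -
  obtain x0 x1 where h: "x0 \<in> G 0" "x1 \<in> G 1" "x = x0 + x1"
    using homogeneous_decomp[of x] .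
  then show ?thesis by (simp add: parity_inv_add D.add D.neg D_degree D.diff)
qed

text \<open>The involution absorbs the sign that depends on the parity of \<open>x\<close>, which
  merges the two rules \<open>B_D\<close> into one for arbitrary \<open>x\<close> and avoids later
  case splits.\<close>

lemma B_D_parity_inv: "B (D (P x)) y = - B x (D y)"
proof -
  obtain x0 x1 where h: "x0 \<in> G 0" "x1 \<in> G 1" "x = x0 + x1"
    using homogeneous_decomp[of x] .
  then show ?thesis by (simp add: parity_inv_add D.add D.neg D.diff B_D B_bilinear_simps)
qed

lemma B_D_eq: "B (D x) y = B x (D (P y))"
proof -
  have "B x (D (P y)) = - B (P x) (D y)"
    by (simp add: D_parity_inv B_bilinear_simps B_parity_inv)
  also have "\<dots> = B (D (P (P x))) y"
    by (simp only: B_D_parity_inv)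
  also have "P (P x) = x"
    by (rule parity_inv_involutive)
  finally show ?thesis by simp
qed

lemma B_parity_inv_X0: "B (P x) X0 = B x X0"
  using X0_even by (simp add: B_parity_inv)

lemma B_X0_commute: "B x X0 = B X0 x"
  using B_commute_even[OF X0_even] by simp

lemma B_parity_inv_D: "B (P x) (D (P y)) = - B x (D y)"
  by (simp flip: B_D_eq add: B_D_parity_inv)

lemma B_X0_parity_inv: "B X0 (P x) = B X0 x"
  using B_parity_inv_X0 by (simp add: B_X0_commute)

text \<open>\<open>D\<close> can be moved across \<open>B\<close> onto \<open>X0\<close>, where it
  vanishes.\<close>

lemma B_D_X0: "B (D x) X0 = 0" "B X0 (D x) = 0"
proof -
  show "B X0 (D x) = 0"
    using B_D(1)[OF X0_even, of x] D_X0 by (simp add: B_bilinear_simps)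
  then show "B (D x) X0 = 0"
    by (simp only: B_X0_commute)
qed

lemma br_X0_commute: "br x X0 = - br X0 x"
  using br_commute_even[OF X0_even, of x] by simp

text \<open>Moving one \<open>D\<close> across \<open>B\<close> produces its square, that is, half
  the bracket with \<open>X0\<close>; invariance then shifts \<open>X0\<close> to the outside. In
  the super Jacobi identity this balances the \<open>e\<^sup>*\<close>-coefficients that are linear
  in \<open>e\<close>.\<close>

lemma B_D_D: "x \<in> G 0 \<Longrightarrow> B (D x) (D y) = (1/2) * B (br x y) X0"
  "x \<in> G 1 \<Longrightarrow> B (D x) (D y) = - (1/2) * B (br x y) X0"
proof -
  have "B x (br X0 y) = B (br x X0) y"
    by (simp add: B_invariant)
  also have "\<dots> = - B X0 (br x y)"
    by (simp add: br_X0_commute B_bilinear_simps B_invariant)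
  finally have *: "B x (br X0 y) = - B (br x y) X0"
    by (simp only: B_X0_commute)
  show "x \<in> G 0 \<Longrightarrow> B (D x) (D y) = (1/2) * B (br x y) X0"
    "x \<in> G 1 \<Longrightarrow> B (D x) (D y) = - (1/2) * B (br x y) X0"
    by (simp_all only: B_D D_D B_bilinear_simps *) simp_all
qed

end

section \<open>The graded vector space underlying the extension\<close>

lemma vector_space_ext:
  fixes scale :: "'k::field_char_0 \<Rightarrow> 'v::ab_group_add \<Rightarrow> 'v"
  shows "vector_space scale \<Longrightarrow> vector_space (ext_scale scale)"
  unfolding vector_space_def ext_scale_def by (auto simp: algebra_simps)

lemma vector_space_field: "vector_space ((*) :: 'k::field \<Rightarrow> 'k \<Rightarrow> 'k)"
  by unfold_locales (simp_all add: algebra_simps)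

lemma mem_ext_grading:
  "(a, x, b) \<in> ext_grading G d \<longleftrightarrow> x \<in> G d \<and> (d = 0 \<longrightarrow> a = 0 \<and> b = 0)"
  by (cases d) (auto simp: ext_grading_def)

lemma (in super_vector_space) super_vector_space_ext:
  "super_vector_space (ext_scale scale) (ext_grading G)"
proof -
  interpret ext: vector_space "ext_scale scale"
    by (rule vector_space_ext) (rule vector_space_axioms)
  show ?thesis
  proof unfold_locales
    show "ext.subspace (ext_grading G d)" for d
      unfolding ext.subspace_def
      by (auto simp: mem_ext_grading ext_scale_def zero_prod_def G_closed)
    show "ext_grading G 0 \<inter> ext_grading G 1 = ({0} :: ('k \<times> 'v \<times> 'k) set)"
      using G_inter G_closed(1) by (auto simp: mem_ext_grading zero_prod_def)
    show "\<exists>u0\<in>ext_grading G 0. \<exists>u1\<in>ext_grading G 1. u = u0 + u1" for u :: "'k \<times> 'v \<times> 'k"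
    proof -
      obtain a x b where u: "u = (a, x, b)" by (cases u)
      obtain x0 x1 where x: "x0 \<in> G 0" "x1 \<in> G 1" "x = x0 + x1"
        using homogeneous_decomp[of x] .
      have "(0, x0, 0) \<in> ext_grading G 0" "(a, x1, b) \<in> ext_grading G 1"
          "u = (0, x0, 0) + (a, x1, b)"
        using x u by (auto simp: mem_ext_grading)
      then show ?thesis by blast
    qed
  qed
qed

section \<open>The extended bracket and its super Jacobi identity\<close>

context double_extension
begin

abbreviation "E \<equiv> ext_bracket scale G br B D X0"

lemma B_odd_X0: "x \<in> G 1 \<Longrightarrow> B x X0 = 0"
  using B_orthogonal[OF _ X0_even] by simp

text \<open>On a homogeneous first argument \<open>parity_inv\<close> is a sign. In the odd rule
  below, the term of the last coefficient with \<open>a'\<close> also drops out, because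
  \<open>X0\<close> is even and hence orthogonal to \<open>x\<close>.\<close>

lemma ext_bracket_even: "x \<in> G 0 \<Longrightarrow> E (0, x, 0) (a', x', b') =
    (0, br x x' - scale a' (D x), a' * B x X0 - B (D x) x')"
  by (simp add: ext_bracket_def)

lemma ext_bracket_odd: "x \<in> G 1 \<Longrightarrow> E (a, x, b) (a', x', b') =
    (0, scale (a * a') X0 + scale a (D x') + scale a' (D x) + br x x',
      - (a * B x' X0) - B (D x) x')"
  by (simp add: ext_bracket_def D.neg B_bilinear_simps B_odd_X0)

lemmas linear_simps = br_bilinear B_bilinear_simps D.add D.diff D.neg D.scale D.zero
  scale_right_distrib scale_left_distrib scale_right_diff_distrib scale_left_diff_distrib
  parity_inv_add parity_inv_diff parity_inv_scale parity_inv_0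

text \<open>Since \<open>e\<^sup>*\<close> is central, the middle component is the Jacobi identity
  of the original algebra and the last one is \<open>skew_superderivation_cyclic\<close>.\<close>

lemma ext_jacobi_even_even_even:
  assumes x: "x \<in> G 0" and y: "y \<in> G 0" and z: "z \<in> G 0"
  shows "E (0, x, 0) (E (0, y, 0) (0, z, 0)) + E (0, y, 0) (E (0, z, 0) (0, x, 0))
    + E (0, z, 0) (E (0, x, 0) (0, y, 0)) = 0"
  proof -
  have jac: "br x (br y z) + br y (br z x) + br z (br x y) = 0"
    using br_jacobi[OF assms] by simp
  have "B (D x) (br y z) + B (D y) (br z x) + B (D z) (br x y) = 0"
    using skew_superderivation_cyclic[OF D_superderivation D_skew assms] by simp
  then show ?thesis
    using assms jac
    by (simp add: ext_bracket_even linear_simps algebra_simps zero_prod_def)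
       (metis add_eq_0_iff)
qed

text \<open>Beyond the terms without \<open>e\<close>, the terms with factor \<open>r\<close> cancel
  by the Leibniz rule for \<open>D\<close> on \<open>br x y\<close> in the middle component and by
  \<open>B_D_D\<close> in the last.\<close>

lemma ext_jacobi_even_even_odd:
  assumes x: "x \<in> G 0" and y: "y \<in> G 0" and z: "z \<in> G 1"
  shows "E (0, x, 0) (E (0, y, 0) (r, z, r')) + E (0, y, 0) (E (r, z, r') (0, x, 0))
    + E (r, z, r') (E (0, x, 0) (0, y, 0)) = 0"
  proof -
  have jac: "br x (br y z) = - br y (br z x) - br z (br x y)"
    using br_jacobi[OF assms] by (simp add: eq_diff_eq eq_neg_iff_add_eq_0 ac_simps)
  have cyc: "B (D x) (br y z) = - B (D y) (br z x) - B (D z) (br x y)"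
    using skew_superderivation_cyclic[OF D_superderivation D_skew assms]
    by (simp add: eq_diff_eq eq_neg_iff_add_eq_0 ac_simps)
  have g: "D (br x y) = br x (D y) - br y (D x)"
    using D_br(1)[OF x, of y] br_skew[OF D_degree(1)[OF x] y] by simp
  have s: "B (D x) (D y) = B (br x y) X0 / 2" "B (D y) (D x) = - B (D x) (D y)"
    using B_D_D(1)[OF x, of y] B_commute_odd[OF D_degree(1)[OF y], of "D x"] by simp_all
  show ?thesis
    using x y z by (simp add: ext_bracket_even ext_bracket_odd br_degree D_degree linear_simps jac cyc g s
      zero_prod_def algebra_simps)
qed

text \<open>The third summand has sign -1 and stands on the right. The last component vanishes by
  parity; in the middle one, two copies of \<open>D (D x)\<close> with factor \<open>q * r\<close>
  meet one bracket with \<open>X0\<close>, and the other mixed terms cancel by the Leibniz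
  rule.\<close>

lemma ext_jacobi_even_odd_odd:
  assumes x: "x \<in> G 0" and y: "y \<in> G 1" and z: "z \<in> G 1"
  shows "E (0, x, 0) (E (q, y, q') (r, z, r')) + E (q, y, q') (E (r, z, r') (0, x, 0))
    = E (r, z, r') (E (0, x, 0) (q, y, q'))"
  proof -
  have jac: "br x (br y z) = br z (br x y) - br y (br z x)"
    using br_jacobi[OF assms] by (simp add: eq_diff_eq)
  have g: "D (br x y) = br (D x) y + br x (D y)" "D (br z x) = br (D z) x - br z (D x)"
    "br (D z) x = - br x (D z)" "br (D x) y = br y (D x)"
    using D_br(1)[OF x, of y] D_br(2)[OF z, of x] br_skew[OF D_degree(2)[OF z] x]
      br_skew[OF D_degree(1)[OF x] y] by simp_all
  have h: "scale c (D (D x)) + scale c (D (D x)) = scale c (br X0 x)" for c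
    by (simp add: D_D flip: scale_left_distrib)
  have o: "B (D x) w = 0" if "w \<in> G 0" for w
    using B_orthogonal[OF D_degree(1)[OF x] that] by simp
  have o': "B (D y) w = 0" "B (D z) w = 0" if "w \<in> G 1" for w
    using B_orthogonal[OF D_degree(2)[OF y] that] B_orthogonal[OF D_degree(2)[OF z] that] by simp_all
  show ?thesis
    using x y z by (simp add: ext_bracket_even ext_bracket_odd br_degree D_degree linear_simps jac g h
      br_X0_commute o o' B_odd_X0 D_X0 zero_prod_def algebra_simps G_closed)
qed

text \<open>Sorted by degree in \<open>p\<close>, \<open>q\<close>, \<open>r\<close>: the constant
  terms vanish by Jacobi and the cyclic identity, the linear ones by the Leibniz rule and
  \<open>B_D_D\<close>, the quadratic ones by the formula for the square of \<open>D\<close> and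
  \<open>B_D_X0\<close>, and the cubic ones by \<open>D X0 = 0\<close> and
  \<open>B X0 X0 = 0\<close>.\<close>

lemma ext_jacobi_odd_odd_odd:
  assumes x: "x \<in> G 1" and y: "y \<in> G 1" and z: "z \<in> G 1"
  shows "E (p, x, p') (E (q, y, q') (r, z, r')) + E (q, y, q') (E (r, z, r') (p, x, p'))
    + E (r, z, r') (E (p, x, p') (q, y, q')) = 0"
  proof -
  have "- br x (br y z) - br y (br z x) = br z (br x y)"
    using br_jacobi[OF assms] by simp
  from this[symmetric] have jac: "br x (br y z) = - br y (br z x) - br z (br x y)"
    by simp
  have "- B (D x) (br y z) - B (D y) (br z x) = B (D z) (br x y)"
    using skew_superderivation_cyclic[OF D_superderivation D_skew assms] by simp
  from this[symmetric] have cyc: "B (D x) (br y z) = - B (D y) (br z x) - B (D z) (br x y)"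
    by simp
  have g: "D (br v w) = - br w (D v) - br v (D w)" if "v \<in> G 1" "w \<in> G 1" for v w
    using D_br(2)[OF that(1)] br_skew[OF D_degree(2)[OF that(1)] that(2)] by simp
  have s: "B (br v w) X0 = - B (D v) (D w) - B (D w) (D v)" if "v \<in> G 1" "w \<in> G 1" for v w
    using B_D_D(2)[OF that(1), of w] B_commute_even[OF D_degree(2)[OF that(1)], of "D w"] by simp
  have h: "scale c (D (D w)) + scale c (D (D w)) = scale c (br X0 w)" for c w
    by (simp add: D_D flip: scale_left_distrib)
  show ?thesis
    using x y z by (simp add: ext_bracket_odd ext_bracket_even br_degree D_degree linear_simps jac cyc g s h
      br_X0_commute B_D_X0 B_X0_X0 D_X0 X0_even G_closed zero_prod_def algebra_simps)
qed

theorem ext_quadratic: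
  "quadratic_lie_superalgebra (ext_scale scale) (ext_grading G) E (ext_form B)"
proof -
  interpret ext: super_vector_space "ext_scale scale" "ext_grading G"
    by (rule super_vector_space_ext)
  show ?thesis
  proof (intro quadratic_lie_superalgebra.intro quadratic_lie_superalgebra_axioms.intro
      lie_superalgebra.intro lie_superalgebra_axioms.intro)
    show "super_vector_space (ext_scale scale) (ext_grading G)"
      by (rule super_vector_space_ext)
    show "Vector_Spaces.linear (ext_scale scale) (ext_scale scale) (\<lambda>v. E u v)" for u
      unfolding Vector_Spaces.linear_iff using ext.vector_space_axioms
      by (cases u) (auto simp: ext_bracket_def ext_scale_def linear_simps algebra_simps)
    show "Vector_Spaces.linear (ext_scale scale) (ext_scale scale) (\<lambda>u. E u v)" for v
      unfolding Vector_Spaces.linear_iff using ext.vector_space_axioms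
      by (cases v) (auto simp: ext_bracket_def ext_scale_def linear_simps algebra_simps)
    \<comment> \<open>For two arguments of equal parity the \<open>e\<^sup>*\<close>-coefficient has
      to vanish. It does, as \<open>D\<close> is odd, \<open>X0\<close> is even and \<open>B\<close>
      pairs only equal parities.\<close>
    show "E u v \<in> ext_grading G (a + b)"
      if "u \<in> ext_grading G a" "v \<in> ext_grading G b" for u v a b
      using that by (cases u; cases v; cases a; cases b)
        (auto simp: mem_ext_grading ext_bracket_even ext_bracket_odd br_degree D_degree X0_even
          B_orthogonal[of _ 1 _ 0] B_orthogonal[of _ 0 _ 1] B_odd_X0 intro!: G_closed)
    show "E u v = - ext_scale scale (ksign (a * b)) (E v u)"
      if "u \<in> ext_grading G a" "v \<in> ext_grading G b" for u v a b
      proof -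
      obtain p x p' q y q' where uv: "u = (p, x, p')" "v = (q, y, q')"
        by (metis surj_pair)
      have xy: "x \<in> G a" "y \<in> G b"
        using that uv by (auto simp: mem_ext_grading)
      have zero: "a = 0 \<Longrightarrow> p = 0 \<and> p' = 0" "b = 0 \<Longrightarrow> q = 0 \<and> q' = 0"
        using that uv by (auto simp: mem_ext_grading)
      note simps = ext_bracket_even ext_bracket_odd ext_scale_def B_D B_odd_X0 uv
      show ?thesis
        using bit_01_cases[of a] bit_01_cases[of b]
      proof (elim disjE)
        assume "a = 0" "b = 0"
        then show ?thesis
          using xy zero br_commute_even[of x y] B_orthogonal[of x 0 "D y" 1]
            B_orthogonal[of y 0 "D x" 1] by (simp add: simps D_degree)
      next
        assume "a = 0" "b = 1"
        then show ?thesis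
          using xy zero br_commute_even[of x y] B_D_commute[of x y] by (simp add: simps)
      next
        assume "a = 1" "b = 0"
        then show ?thesis
          using xy zero br_commute_even[of y x] B_D_commute[of y x] by (simp add: simps)
      next
        assume "a = 1" "b = 1"
        then show ?thesis
          using xy zero br_commute_odd[of x y] B_orthogonal[of x 1 "D y" 0]
            B_orthogonal[of y 1 "D x" 0] by (simp add: simps D_degree ac_simps)
      qed
    qed
    show "ext_scale scale (ksign (a * c)) (E u (E v w)) + ext_scale scale (ksign (a * b)) (E v (E w u))
        + ext_scale scale (ksign (b * c)) (E w (E u v)) = 0"
      if "u \<in> ext_grading G a" "v \<in> ext_grading G b" "w \<in> ext_grading G c" for u v w a b c
      proof -
      obtain p x p' q y q' r z r' where uvw: "u = (p, x, p')" "v = (q, y, q')" "w = (r, z, r')"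
        by (metis surj_pair)
      have xyz: "x \<in> G a" "y \<in> G b" "z \<in> G c"
        using that uvw by (auto simp: mem_ext_grading)
      have zero: "a = 0 \<Longrightarrow> p = 0 \<and> p' = 0" "b = 0 \<Longrightarrow> q = 0 \<and> q' = 0" "c = 0 \<Longrightarrow> r = 0 \<and> r' = 0"
        using that uvw by (auto simp: mem_ext_grading)
      show ?thesis
        using bit_01_cases[of a] bit_01_cases[of b] bit_01_cases[of c]
      proof (elim disjE)
        assume "a = 0" "b = 0" "c = 0"
        then show ?thesis
          using xyz zero ext_jacobi_even_even_even[of x y z] by (simp add: uvw)
      next
        assume "a = 0" "b = 0" "c = 1"
        then show ?thesis
          using xyz zero ext_jacobi_even_even_odd[of x y z r r'] by (simp add: uvw)
      next
        assume "a = 0" "b = 1" "c = 0"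
        then show ?thesis
          using xyz zero ext_jacobi_even_even_odd[of z x y q q'] by (simp add: uvw ac_simps)
      next
        assume "a = 1" "b = 0" "c = 0"
        then show ?thesis
          using xyz zero ext_jacobi_even_even_odd[of y z x p p'] by (simp add: uvw ac_simps)
      next
        assume "a = 0" "b = 1" "c = 1"
        then show ?thesis
          using xyz zero ext_jacobi_even_odd_odd[of x y z q q' r r'] by (simp add: uvw)
      next
        assume "a = 1" "b = 0" "c = 1"
        then show ?thesis
          using xyz zero ext_jacobi_even_odd_odd[of y z x r r' p p', symmetric]
          by (simp add: uvw)
      next
        assume "a = 1" "b = 1" "c = 0"
        then show ?thesis
          using xyz zero ext_jacobi_even_odd_odd[of z x y p p' q q', symmetric]
          by (simp add: uvw)
      next
        assume "a = 1" "b = 1" "c = 1"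
        then show ?thesis
          using xyz minus_sum3[OF ext_jacobi_odd_odd_odd[of x y z p p' q q' r r']]
          by (simp only: uvw bit_arith ksign_simps ext.scale_minus_left ext.scale_one)
      qed
    qed
    show "bilinear_form (ext_scale scale) (ext_form B)"
      unfolding bilinear_form_def Vector_Spaces.linear_iff
      using ext.vector_space_axioms vector_space_field
      by (auto simp: ext_form_def ext_scale_def B_bilinear_simps algebra_simps)
    show "even_form (ext_grading G) (ext_form B)"
      using B_even unfolding even_form_def
      by (auto simp: mem_ext_grading ext_form_def)
    show "nondegenerate_form (ext_form B)"
      unfolding nondegenerate_form_def
    proof (intro conjI allI impI)
      fix u :: "'k \<times> 'v \<times> 'k"
      obtain a x b where u: "u = (a, x, b)" by (cases u)
      show "u = 0" if h: "\<forall>v. ext_form B u v = 0"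
      proof -
        have "\<forall>y. B x y = 0"
          using h[rule_format, of "(0, _, 0)"] by (simp add: u ext_form_def)
        then have "x = 0"
          using B_nondegenerate unfolding nondegenerate_form_def by blast
        then show ?thesis
          using h[rule_format, of "(1, 0, 0)"] h[rule_format, of "(0, 0, 1)"]
          by (simp add: u ext_form_def zero_prod_def B_bilinear_simps)
      qed
      show "u = 0" if h: "\<forall>v. ext_form B v u = 0"
      proof -
        have "\<forall>y. B y x = 0"
          using h[rule_format, of "(0, _, 0)"] by (simp add: u ext_form_def)
        then have "x = 0"
          using B_nondegenerate unfolding nondegenerate_form_def by blast
        then show ?thesis
          using h[rule_format, of "(1, 0, 0)"] h[rule_format, of "(0, 0, 1)"]
          by (simp add: u ext_form_def zero_prod_def B_bilinear_simps)
      qed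
    qed
    show "supersymmetric_form (ext_grading G) (ext_form B)"
      unfolding supersymmetric_form_def
    proof (intro allI ballI)
      fix a b and u v :: "'k \<times> 'v \<times> 'k"
      assume "u \<in> ext_grading G a" "v \<in> ext_grading G b"
      then show "ext_form B u v = ksign (a * b) * ext_form B v u"
        by (cases u; cases v; cases a; cases b)
          (auto simp: mem_ext_grading ext_form_def B_orthogonal[of _ 1 _ 0] B_orthogonal[of _ 0 _ 1]
            intro: B_commute_even dest: B_commute_odd)
    qed
    \<comment> \<open>The rules formulated with \<open>P\<close> permit a computation with
      inhomogeneous elements.\<close>
    show "ext_form B (E u v) w = ext_form B u (E v w)" for u v w
      by (cases u; cases v; cases w)
        (simp add: ext_form_def ext_bracket_def linear_simps B_invariant B_X0_parity_inv
          B_parity_inv_D B_D_eq B_X0_commute algebra_simps)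
  qed
qed

section \<open>Extending the superderivation\<close>

text \<open>The coefficient \<open>- B x A1\<close> balances the \<open>A1\<close> in the image of
  \<open>e\<close>, because \<open>A1\<close> is odd; \<open>\<mu>\<close> contributes the same
  symmetric term to both sides.\<close>

lemma ext_map_skew:
  assumes \<delta>: "Vector_Spaces.linear scale scale \<delta>"
    and skew: "skew_supersymmetric_map G B 0 \<delta>" and A1: "A1 \<in> G 1"
  shows "skew_supersymmetric_map (ext_grading G) (ext_form B) 0 (ext_map scale B \<delta> \<alpha> \<mu> A1)"
proof -
  have *: "B (\<delta> x) y = - B x (\<delta> y)" for x y
    by (rule skew_map_even[OF \<delta> skew])
  show ?thesis
    unfolding skew_supersymmetric_map_def
    using B_commute_odd[OF A1]
    by (auto simp: ext_form_def ext_map_def linear_simps * algebra_simps)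
qed

text \<open>The rule is verified on arbitrary triples: the hypotheses become rewrite rules that move
  \<open>\<delta>\<close> inwards, and their pairings with \<open>B\<close> handle the
  \<open>e\<^sup>*\<close>-coefficients.\<close>

lemma ext_map_superderivation:
  assumes \<delta>: "superderivation scale G br 0 \<delta>" and skew: "skew_supersymmetric_map G B 0 \<delta>"
    and A1: "A1 \<in> G 1"
    and comm: "\<And>x. \<delta> (D x) - D (\<delta> x) + scale \<alpha> (D x) = br A1 x"
    and D_A1: "D A1 = scale \<alpha> X0 + scale (1/2) (\<delta> X0)"
  shows "superderivation (ext_scale scale) (ext_grading G) E 0 (ext_map scale B \<delta> \<alpha> \<mu> A1)"
proof -
  interpret \<delta>: Vector_Spaces.linear scale scale \<delta>
    using \<delta> unfolding superderivation_def by blast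
  interpret ext: vector_space "ext_scale scale"
    by (rule vector_space_ext) (rule vector_space_axioms)
  have \<delta>_degree: "x \<in> G a \<Longrightarrow> \<delta> x \<in> G a" for x a
    using \<delta> unfolding superderivation_def by (metis add.right_neutral)
  have \<delta>_br: "\<delta> (br x y) = br (\<delta> x) y + br x (\<delta> y)" for x y
    by (rule superderivation_even[OF \<delta>])
  have \<delta>_parity_inv: "\<delta> (P x) = P (\<delta> x)" for x
  proof -
    obtain x0 x1 where h: "x0 \<in> G 0" "x1 \<in> G 1" "x = x0 + x1"
      using homogeneous_decomp[of x] .
    then show ?thesis
      by (simp add: parity_inv_add \<delta>.add \<delta>.neg \<delta>.diff \<delta>_degree)
  qed
  have B_\<delta>: "B (\<delta> x) y = - B x (\<delta> y)" for x y
    by (rule skew_map_even[OF \<delta>.linear_axioms skew])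
  have \<delta>_D: "\<delta> (D x) = D (\<delta> x) - scale \<alpha> (D x) + br A1 x" for x
    using comm[of x] by (simp add: algebra_simps)
  \<comment> \<open>This is the derivation rule on \<open>[e, e] = X0\<close>: \<open>e\<close> is
    sent to \<open>A1 - \<alpha> e\<close> up to a multiple of \<open>e\<^sup>*\<close>, and both
    \<open>[e, A1]\<close> and \<open>[A1, e]\<close> equal \<open>D A1\<close>.\<close>
  have \<delta>_X0: "\<delta> X0 = D A1 + D A1 - scale \<alpha> X0 - scale \<alpha> X0"
  proof -
    have "scale (1/2) (\<delta> X0) + scale (1/2) (\<delta> X0) = \<delta> X0"
      by (simp flip: scale_left_distrib)
    then show ?thesis by (simp add: D_A1 algebra_simps)
  qed
  have br_A1: "br x A1 = - br A1 (P x)" for x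
  proof -
    obtain x0 x1 where h: "x0 \<in> G 0" "x1 \<in> G 1" "x = x0 + x1"
      using homogeneous_decomp[of x] .
    then show ?thesis
      using br_commute_even[OF h(1), of A1] br_commute_odd[OF h(2) A1]
      by (simp add: parity_inv_add br_bilinear)
  qed
  have P_br_A1: "P (br A1 x) = - br A1 (P x)" for x
  proof -
    obtain x0 x1 where h: "x0 \<in> G 0" "x1 \<in> G 1" "x = x0 + x1"
      using homogeneous_decomp[of x] .
    then show ?thesis
      using A1 by (simp add: parity_inv_add br_bilinear br_degree)
  qed
  have P_D_A1: "P (D A1) = D A1"
    using A1 D_degree by simp
  have B_P_D: "B (P (D x)) A1 = - B (D x) A1" for x
    using A1 by (simp add: B_parity_inv B_bilinear_simps)
  \<comment> \<open>Pairing the hypothesis on \<open>D A1\<close> with \<open>x\<close> yields the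
    \<open>e\<^sup>*\<close>-coefficient of the rule on \<open>[e, x]\<close>.\<close>
  have B_D_A1: "B (D A1) x = \<alpha> * B x X0 - B (\<delta> x) X0 / 2" for x
  proof -
    have "B (\<delta> X0) x = - B (\<delta> x) X0"
      using B_\<delta>[of X0 x] B_X0_commute[of "\<delta> x"] by simp
    then show ?thesis
      using B_X0_commute[of x] by (simp add: D_A1 B_bilinear_simps)
  qed
  have B_D_odd: "B x (D A1) = B (D A1) x" for x
    using B_commute_even[OF D_degree(2)[OF A1], of x] by simp
  have B_D_x: "B (D x) A1 = - B (D A1) x" for x
    using B_D(2)[OF A1, of x] B_commute_odd[OF A1, of "D x"] by simp
  have B_br: "B (br x y) A1 = - B (br A1 x) y" for x y
    using B_commute_odd[OF A1, of "br x y"] by (simp add: B_invariant)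
  \<comment> \<open>Pairing \<open>\<delta>_D\<close> with \<open>y\<close> yields, together with
    \<open>B_br\<close>, the \<open>e\<^sup>*\<close>-coefficient of the rule on
    \<open>[x, y]\<close>.\<close>
  have B_D_\<delta>: "B (D x) (\<delta> y) = - B (D (\<delta> x)) y + \<alpha> * B (D x) y - B (br A1 x) y" for x y
    using B_\<delta>[of "D x" y] by (simp add: \<delta>_D B_bilinear_simps algebra_simps)
  have A1_X0: "B A1 X0 = 0" "B X0 A1 = 0"
    using B_odd_X0[OF A1] B_X0_commute[of A1] by simp_all
  show ?thesis
    unfolding superderivation_def
  proof (intro conjI allI ballI)
    show "Vector_Spaces.linear (ext_scale scale) (ext_scale scale) (ext_map scale B \<delta> \<alpha> \<mu> A1)"
      unfolding Vector_Spaces.linear_iff using ext.vector_space_axioms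
      by (auto simp: ext_map_def ext_scale_def linear_simps \<delta>.add \<delta>.scale algebra_simps)
    show "ext_map scale B \<delta> \<alpha> \<mu> A1 u \<in> ext_grading G (a + 0)" if "u \<in> ext_grading G a" for a u
      using that B_orthogonal[OF _ A1]
      by (cases u; cases a) (auto simp: mem_ext_grading ext_map_def \<delta>_degree A1 G_closed)
    show "ext_map scale B \<delta> \<alpha> \<mu> A1 (E u v) = E (ext_map scale B \<delta> \<alpha> \<mu> A1 u) v
        + ext_scale scale (ksign (0 * a)) (E u (ext_map scale B \<delta> \<alpha> \<mu> A1 v))" for a u v
    proof -
      obtain p x p' q y q' where uv: "u = (p, x, p')" "v = (q, y, q')"
        by (metis surj_pair)
      \<comment> \<open>\<open>B_D_A1\<close> is kept for the second pass, after
        \<open>B_D_odd\<close> and \<open>B_D_x\<close> have rewritten pairings to the form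
        \<open>B (D A1) x\<close>.\<close>
      show ?thesis
        unfolding uv ext_bracket_def ext_map_def ext_scale_def
        by (simp add: linear_simps \<delta>.add \<delta>.diff \<delta>.neg \<delta>.scale \<delta>_br \<delta>_parity_inv \<delta>_D \<delta>_X0 br_A1
          A1 B_parity_inv_X0 B_D_parity_inv B_D_odd B_D_x B_br B_D_\<delta> A1_X0 D_parity_inv P_br_A1 P_D_A1 B_P_D,
          simp add: linear_simps B_D_A1 algebra_simps A1_X0)
    qed
  qed
qed

text \<open>The map is block triangular with diagonal \<open>- \<alpha>\<close>,
  \<open>\<delta>\<close>, \<open>\<alpha>\<close>; the explicit right inverse solves for
  \<open>a\<close>, \<open>x\<close> and the last coefficient in this order.\<close>

lemma bij_ext_map:
  assumes \<delta>: "bij \<delta>" and \<alpha>: "\<alpha> \<noteq> 0"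
  shows "bij (ext_map scale B \<delta> \<alpha> \<mu> A1)"
proof (rule bijI)
  show "inj (ext_map scale B \<delta> \<alpha> \<mu> A1)"
    using \<delta> \<alpha> by (auto intro!: injI simp: ext_map_def bij_is_inj inj_eq)
  show "surj (ext_map scale B \<delta> \<alpha> \<mu> A1)"
  proof (rule surjI)
    show "ext_map scale B \<delta> \<alpha> \<mu> A1 ((\<lambda>(p, q, r).
        let a = - (p / \<alpha>); x = inv \<delta> (q - scale a A1)
        in (a, x, (r - \<mu> * a + B x A1) / \<alpha>)) u) = u" for u
      using \<delta> \<alpha> by (cases u) (simp add: ext_map_def Let_def bij_is_surj surj_f_inv_f)
  qed
qed

end

section \<open>The extended flag\<close>

lemma finite_dimensional_field: "finite_dimensional_vector_space ((*) :: 'k::field \<Rightarrow> 'k \<Rightarrow> 'k) {1}"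
proof -
  interpret vector_space "(*) :: 'k \<Rightarrow> 'k \<Rightarrow> 'k" by (rule vector_space_field)
  show ?thesis
    by unfold_locales (auto simp: span_singleton)
qed

text \<open>Identifies the extension with an iterated product of vector spaces, for which the
  dimension formula for products of subspaces is available.\<close>

lemma ext_scale_eq_module_prod:
  fixes scale :: "'k::field_char_0 \<Rightarrow> 'v::ab_group_add \<Rightarrow> 'v"
  assumes "vector_space scale"
  shows "ext_scale scale = module_prod.scale (*) (module_prod.scale scale (*))"
proof -
  interpret k: vector_space "(*) :: 'k \<Rightarrow> 'k \<Rightarrow> 'k" by (rule vector_space_field)
  interpret vector_space scale by (rule assms)
  interpret l: vector_space_prod scale "(*) :: 'k \<Rightarrow> 'k \<Rightarrow> 'k" by unfold_locales
  interpret vector_space_prod "(*) :: 'k \<Rightarrow> 'k \<Rightarrow> 'k" l.scale by unfold_locales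
  show ?thesis
    by (simp add: fun_eq_iff ext_scale_def scale_prod l.scale_prod)
qed

lemma
  fixes scale :: "'k::field_char_0 \<Rightarrow> 'v::ab_group_add \<Rightarrow> 'v"
  assumes fd: "finite_dimensional_vector_space scale Bs"
  shows finite_dimensional_ext: "\<exists>Bs'. finite_dimensional_vector_space (ext_scale scale) Bs'"
    and dim_ext: "module.subspace scale S \<Longrightarrow>
      vector_space.dim (ext_scale scale) ({0} \<times> S \<times> UNIV) = vector_space.dim scale S + 1"
      "module.subspace scale S \<Longrightarrow>
      vector_space.dim (ext_scale scale) (UNIV \<times> S \<times> UNIV) = vector_space.dim scale S + 2"
proof -
  interpret finite_dimensional_vector_space scale Bs by (rule fd)
  interpret k: finite_dimensional_vector_space "(*) :: 'k \<Rightarrow> 'k \<Rightarrow> 'k" "{1}"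
    by (rule finite_dimensional_field)
  interpret l: finite_dimensional_vector_space_prod scale "(*) :: 'k \<Rightarrow> 'k \<Rightarrow> 'k" Bs "{1}"
    by unfold_locales
  interpret p: finite_dimensional_vector_space_prod "(*) :: 'k \<Rightarrow> 'k \<Rightarrow> 'k" l.scale "{1}" l.Basis_pair
    by unfold_locales
  have eq: "ext_scale scale = p.scale"
    by (rule ext_scale_eq_module_prod) (rule vector_space_axioms)
  have k1: "k.dim (UNIV :: 'k set) = 1"
    by (subst k.dim_UNIV) simp
  have k0: "k.dim ({0} :: 'k set) = 0"
    by (subst k.dim_eq_0) simp
  show "\<exists>Bs'. finite_dimensional_vector_space (ext_scale scale) Bs'"
    unfolding eq by (rule exI) (rule p.p.finite_dimensional_vector_space_axioms)
  assume S: "subspace S"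
  have SU: "l.p.subspace (S \<times> UNIV)"
    by (rule l.subspace_Times[OF S k.subspace_UNIV])
  have *: "l.p.dim (S \<times> UNIV) = dim S + 1"
    using l.dim_Times[OF S k.subspace_UNIV] k1 by simp
  show "vector_space.dim (ext_scale scale) ({0} \<times> S \<times> UNIV) = dim S + 1"
    unfolding eq using p.dim_Times[OF k.subspace_single_0 SU] * k0 by simp
  show "vector_space.dim (ext_scale scale) (UNIV \<times> S \<times> UNIV) = dim S + 2"
    unfolding eq using p.dim_Times[OF k.subspace_UNIV SU] * k1 by simp
qed

text \<open>The product form matches the subspaces treated in \<open>dim_ext\<close>.\<close>

lemma ext_flag_Times:
  "ext_flag m V i = (if i = 0 then {0} else if i \<le> m + 1 then {0} \<times> V (i - 1) \<times> UNIV
    else UNIV \<times> V m \<times> UNIV)"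
  by (auto simp: ext_flag_def)

section \<open>Filiform flags in finite dimension\<close>

context filiform_lie_superalgebra
begin

text \<open>Finite dimension matters: an infinite basis also has \<open>card\<close> 0, so dimension
  0 alone would not force the zero space.\<close>

lemma V_0:
  assumes fd: "finite_dimensional_vector_space scale Bs"
  shows "V 0 = {0}"
proof -
  interpret finite_dimensional_vector_space scale Bs by (rule fd)
  show ?thesis
    using V_dim[of 0] subspace_0[OF V_subspace[of 0]] by auto
qed

lemma V_mono_le: "i \<le> j \<Longrightarrow> j \<le> m \<Longrightarrow> V i \<subseteq> V j"
proof (induction rule: dec_induct)
  case (step n)
  then show ?case using V_mono[of n] by auto
qed simp

lemma br_V: "x \<in> G 0 \<Longrightarrow> v \<in> V (Suc i) \<Longrightarrow> i < m \<Longrightarrow> br x v \<in> V i"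
  using V_bracket[of i] span_base[of "br x v" "{br x v | x v. x \<in> G 0 \<and> v \<in> V (Suc i)}"]
  by blast

text \<open>\<open>V (m - 1)\<close> has codimension one in \<open>V m\<close>, and
  \<open>V m \<inter> W\<close> lies strictly above it, so it has full dimension.\<close>

lemma V_top_subset:
  assumes fd: "finite_dimensional_vector_space scale Bs"
    and W: "subspace W" "V (m - 1) \<subseteq> W" and x: "x \<in> V m" "x \<notin> V (m - 1)" "x \<in> W"
  shows "V m \<subseteq> W"
proof -
  interpret finite_dimensional_vector_space scale Bs by (rule fd)
  have sub: "subspace (V m \<inter> W)"
    using W(1) V_subspace[of m] by (simp add: subspace_inter)
  have "V (m - 1) \<subset> V m \<inter> W"
    using x W(2) V_mono_le[of "m - 1" m] by auto
  then have "dim (V (m - 1)) < dim (V m \<inter> W)"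
    using sub V_subspace[of "m - 1"] by (intro dim_psubset) (simp only: span_eq_iff[THEN iffD2])
  then have "dim (V m) \<le> dim (V m \<inter> W)"
    using V_dim by simp
  then have "V m \<inter> W = V m"
    using sub V_subspace[of m] by (intro subspace_dim_equal) auto
  then show ?thesis by blast
qed

end

section \<open>Brackets along the extended flag\<close>

context double_extension
begin

text \<open>A vector \<open>v\<close> of \<open>V 1\<close> orthogonal to \<open>em\<close> is
  orthogonal to \<open>V (m - 1)\<close> as well, hence to all odd elements; as it is odd, it lies
  in the radical of \<open>B\<close>.\<close>

lemma B_em_V_1:
  assumes fd: "finite_dimensional_vector_space scale Bs"
    and fil: "filiform_lie_superalgebra scale G br m V"
    and em: "em \<in> V m" "em \<notin> V (m - 1)" and v: "v \<in> V 1" "B em v = 0"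
  shows "v = 0"
proof -
  interpret filiform_lie_superalgebra scale G br m V by (rule fil)
  define W where "W = {y. B y v = 0}"
  have W: "subspace W"
    unfolding W_def subspace_def by (simp add: B_bilinear_simps)
  have v1: "v \<in> G 1"
    using v V_mono_le[of 1 m] m_pos V_top by auto
  \<comment> \<open>Invariance turns this into \<open>- B w (br x v)\<close>, and
    \<open>br x v\<close> lies in \<open>V 0\<close>, which is zero.\<close>
  have "B (br x w) v = 0" if "x \<in> G 0" "w \<in> V m" for x w
  proof -
    have "w \<in> G 1" using that V_top by simp
    then have "br x w = - br w x"
      using br_commute_even[OF that(1)] by simp
    moreover have "br x v = 0"
      using br_V[of x v 0] that(1) v(1) m_pos V_0[OF fd] by simp
    ultimately show ?thesis
      by (simp add: B_bilinear_simps B_invariant)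
  qed
  then have "{br x w | x w. x \<in> G 0 \<and> w \<in> V (Suc (m - 1))} \<subseteq> W"
    using m_pos by (auto simp: W_def)
  from span_minimal[OF this W] have "V (m - 1) \<subseteq> W"
    using V_bracket[of "m - 1"] m_pos by simp
  then have "V m \<subseteq> W"
    using V_top_subset[OF fd W] em v by (simp add: W_def)
  then have odd: "B y v = 0" if "y \<in> G 1" for y
    using that V_top by (auto simp: W_def)
  have "B y v = 0" for y
  proof -
    obtain y0 y1 where "y0 \<in> G 0" "y1 \<in> G 1" "y = y0 + y1"
      using homogeneous_decomp[of y] .
    then show ?thesis
      using odd[of y1] B_orthogonal[of y0 0 v 1] v1 by (simp add: B_bilinear_simps)
  qed
  then show ?thesis
    using B_nondegenerate unfolding nondegenerate_form_def by blast
qed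

text \<open>With \<open>e\<^sup>*\<close> at the bottom, indices shift by one: up to level
  \<open>m + 1\<close> the middle component at level \<open>i > 0\<close> is
  \<open>V (i - 1)\<close>. The bracket condition is proved separately for \<open>i = 0\<close>, for
  \<open>1 \<le> i \<le> m\<close>, and for \<open>i = m + 1\<close>, where \<open>e\<close>
  enters.\<close>

theorem ext_filiform:
  assumes fd: "finite_dimensional_vector_space scale Bs"
    and fil: "filiform_lie_superalgebra scale G br m V"
    and em: "em \<in> V m" "em \<notin> V (m - 1)" "em \<in> D ` G 0"
  shows "filiform_lie_superalgebra (ext_scale scale) (ext_grading G) E (m + 2) (ext_flag m V)"
proof -
  interpret filiform_lie_superalgebra scale G br m V by (rule fil)
  interpret ext: quadratic_lie_superalgebra "ext_scale scale" "ext_grading G" E "ext_form B"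
    by (rule ext_quadratic)
  interpret finite_dimensional_vector_space scale Bs by (rule fd)
  let ?F = "ext_flag m V"
  let ?S = "\<lambda>i. {E u v | u v. u \<in> ext_grading G 0 \<and> v \<in> ?F (Suc i)}"
  obtain g0 where g0: "g0 \<in> G 0" "D g0 = em" using em by blast
  have F_subspace: "ext.subspace (?F i)" for i
    using V_subspace[of "i - 1"] V_subspace[of m]
    by (auto simp: ext_flag_Times ext.subspace_def subspace_def ext_scale_def zero_prod_def)
  have odd_Times: "ext_grading G 1 = UNIV \<times> V m \<times> UNIV"
    by (auto simp: ext_grading_def V_top)
  have F_mono: "?F i \<subseteq> ?F (Suc i)" if "i < m + 2" for i
    using that V_mono[of "i - 1"] subspace_0[OF V_subspace[of "i - 1"]]
    by (cases i; cases "i = Suc m") (auto simp: ext_flag_Times zero_prod_def)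
  have sub: "?S i \<subseteq> ?F i" if "i < m + 2" for i
  proof
    fix w assume "w \<in> ?S i"
    then obtain u v where uv: "u \<in> ext_grading G 0" "v \<in> ?F (Suc i)" and w: "w = E u v"
      by blast
    obtain g where g: "g \<in> G 0" "u = (0, g, 0)"
      using uv(1) by (auto simp: ext_grading_def)
    obtain a x b where v: "v = (a, x, b)" by (cases v)
    \<comment> \<open>At the bottom all brackets vanish because \<open>V 0\<close> is zero and
      \<open>e\<^sup>*\<close> is central. Only for \<open>i = Suc m\<close> can \<open>v\<close>
      have an \<open>e\<close>-coefficient; its contribution is a multiple of \<open>D g\<close>,
      which is odd.\<close>
    consider "i = 0" | j where "i = Suc j" "j < m" | "i = Suc m"
      using \<open>i < m + 2\<close> by (cases i) force+
    then have "E u v \<in> ?F i"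
    proof cases
      case 1
      then show ?thesis
        using uv g v V_0[OF fd] by (simp add: ext_flag_Times ext_bracket_even linear_simps zero_prod_def)
    next
      case 2
      then show ?thesis
        using uv g v br_V[of g x j] by (simp add: ext_flag_Times ext_bracket_even linear_simps)
    next
      case 3
      then show ?thesis
        using uv g v D_degree(1)[of g] V_top br_degree(2)[of g x]
        by (simp add: ext_flag_Times ext_bracket_even G_closed)
    qed
    then show "w \<in> ?F i" by (simp only: w)
  qed
  have S_memI: "E u v \<in> ?S i" if "u \<in> ext_grading G 0" "v \<in> ?F (Suc i)" for u v i
    using that by blast
  \<comment> \<open>The middle components found in a span form a subspace, so
    \<open>span_minimal\<close> and \<open>V_top_subset\<close> can be applied in the original
    algebra.\<close>
  have W_subspace: "subspace {y. (0, y, 0) \<in> ext.span S}" for S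
    unfolding subspace_def
  proof (intro conjI ballI allI; clarify)
    show "(0, 0, 0) \<in> ext.span S"
      using ext.span_zero[of S] by (simp add: zero_prod_def)
    fix x y assume xy: "(0, x, 0) \<in> ext.span S"
    show "(0, scale c x, 0) \<in> ext.span S" for c
      using ext.span_scale[OF xy, of c] by (simp add: ext_scale_def)
    assume "(0, y, 0) \<in> ext.span S"
    from ext.span_add[OF xy this] show "(0, x + y, 0) \<in> ext.span S" by simp
  qed
  have es: "(0, 0, 1) \<in> ext.span (?S i)" if i: "1 \<le> i" "i \<le> m" for i
  proof -
    have "V 1 \<noteq> {0}"
      using V_dim[of 1] m_pos by auto
    then obtain e1 where e1: "e1 \<in> V 1" "e1 \<noteq> 0"
      using subspace_0[OF V_subspace[of 1]] m_pos by auto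
    have ne: "B em e1 \<noteq> 0"
      using B_em_V_1[OF fd fil em(1,2) e1(1)] e1(2) by blast
    \<comment> \<open>In the original algebra \<open>g0\<close> kills \<open>e1\<close>, so this
      bracket consists of its \<open>e\<^sup>*\<close>-coefficient alone. It is a generator at every
      level from 1 to \<open>m\<close>, as \<open>V 1 \<subseteq> V i\<close>.\<close>
    have "E (0, g0, 0) (0, e1, 0) \<in> ?S i"
      using g0 e1 i V_mono_le[of 1 i]
      by (intro S_memI) (auto simp: mem_ext_grading ext_flag_Times)
    from ext.span_base[OF this]
    have "E (0, g0, 0) (0, e1, 0) \<in> ext.span (?S i)" .
    also have "E (0, g0, 0) (0, e1, 0) = (0, 0, - B em e1)"
      using br_V[of g0 e1 0] g0 e1 m_pos V_0[OF fd]
      by (simp add: ext_bracket_even linear_simps)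
    finally have "(0, 0, - B em e1) \<in> ext.span (?S i)" .
    then have "ext_scale scale (- inverse (B em e1)) (0, 0, - B em e1) \<in> ext.span (?S i)"
      by (rule ext.span_scale)
    then show ?thesis using ne by (simp add: ext_scale_def)
  qed
  have span_eq: "ext.span (?S i) = ?F i" if i: "1 \<le> i" "i \<le> m" for i
  proof
    show "ext.span (?S i) \<subseteq> ?F i"
      using ext.span_minimal[OF sub F_subspace, of i] i by simp
    have esb: "(0, 0, b) \<in> ext.span (?S i)" for b
      using ext.span_scale[OF es[OF i], of b] by (simp add: ext_scale_def)
    define W where "W = {y. (0, y, 0) \<in> ext.span (?S i)}"
    have W: "subspace W"
      unfolding W_def by (rule W_subspace)
    have "br x v \<in> W" if xv: "x \<in> G 0" "v \<in> V (Suc (i - 1))" for x v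
    proof -
      have "E (0, x, 0) (0, v, 0) \<in> ?S i"
        using xv i
        by (intro S_memI) (auto simp: mem_ext_grading ext_flag_Times)
      \<comment> \<open>The added multiple of \<open>e\<^sup>*\<close> removes the last coefficient,
        which leaves \<open>br x v\<close>.\<close>
      then have "E (0, x, 0) (0, v, 0) + (0, 0, B (D x) v) \<in> ext.span (?S i)"
        by (intro ext.span_add ext.span_base esb)
      then show ?thesis
        using xv by (simp add: W_def ext_bracket_even linear_simps)
    qed
    then have "{br x v | x v. x \<in> G 0 \<and> v \<in> V (Suc (i - 1))} \<subseteq> W" by blast
    from span_minimal[OF this W] have VW: "V (i - 1) \<subseteq> W"
      using V_bracket[of "i - 1"] i by simp
    show "?F i \<subseteq> ext.span (?S i)"
    proof
      fix v :: "'k \<times> 'v \<times> 'k"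
      assume "v \<in> ?F i"
      then obtain y b where v: "v = (0, y, b)" "y \<in> V (i - 1)"
        using i by (auto simp: ext_flag_Times)
      have "(0, y, 0) + (0, 0, b) \<in> ext.span (?S i)"
        using VW v(2) esb[of b] by (intro ext.span_add) (auto simp: W_def)
      then show "v \<in> ext.span (?S i)" by (simp add: v)
    qed
  qed
  have span_top: "ext.span (?S (Suc m)) = ?F (Suc m)"
  proof
    show "ext.span (?S (Suc m)) \<subseteq> ?F (Suc m)"
      using ext.span_minimal[OF sub F_subspace] by simp
    \<comment> \<open>The generators of level \<open>m\<close> already provide
      \<open>V (m - 1)\<close> and \<open>e\<^sup>*\<close>; only \<open>em\<close> is
      missing.\<close>
    have "?S m \<subseteq> ?S (Suc m)"
      using F_mono[of "Suc m"] by fastforce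
    then have "ext.span (?S m) \<subseteq> ext.span (?S (Suc m))"
      by (rule ext.span_mono)
    then have Fm: "?F m \<subseteq> ext.span (?S (Suc m))"
      using span_eq[of m] m_pos by simp
    define W where "W = {y. (0, y, 0) \<in> ext.span (?S (Suc m))}"
    have esb: "(0, 0, b) \<in> ext.span (?S (Suc m))" for b
      using Fm m_pos subspace_0[OF V_subspace[of "m - 1"]] by (auto simp: ext_flag_Times)
    have W: "subspace W"
      unfolding W_def by (rule W_subspace)
    have "V (m - 1) \<subseteq> W"
      using Fm m_pos by (auto simp: W_def ext_flag_Times)
    moreover have "em \<in> W"
    proof -
      \<comment> \<open>Bracketing \<open>g0\<close> with \<open>- e\<close> gives the middle
        component \<open>+ D g0 = em\<close>; its \<open>e\<^sup>*\<close>-coefficient is then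
        removed.\<close>
      have "E (0, g0, 0) (- 1, 0, 0) \<in> ?S (Suc m)"
        using g0 subspace_0[OF V_subspace[of m]]
        by (intro S_memI) (auto simp: mem_ext_grading ext_flag_Times)
      then have "E (0, g0, 0) (- 1, 0, 0) + (0, 0, B g0 X0) \<in> ext.span (?S (Suc m))"
        by (intro ext.span_add ext.span_base esb)
      then show ?thesis
        using g0 by (simp add: W_def ext_bracket_even linear_simps)
    qed
    ultimately have VW: "V m \<subseteq> W"
      using V_top_subset[OF fd W] em by blast
    show "?F (Suc m) \<subseteq> ext.span (?S (Suc m))"
    proof
      fix v :: "'k \<times> 'v \<times> 'k"
      assume "v \<in> ?F (Suc m)"
      then obtain y b where v: "v = (0, y, b)" "y \<in> V m"
        by (auto simp: ext_flag_Times)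
      have "(0, y, 0) + (0, 0, b) \<in> ext.span (?S (Suc m))"
        using VW v(2) esb[of b] by (intro ext.span_add) (auto simp: W_def)
      then show "v \<in> ext.span (?S (Suc m))" by (simp add: v)
    qed
  qed
  show ?thesis
  proof unfold_locales
    show "ext.dim (ext_grading G 1) = m + 2"
      using dim_ext(2)[OF fd V_subspace[of m]] V_dim[of m] by (simp add: odd_Times)
    show "?F (m + 2) = ext_grading G 1"
      by (simp add: odd_Times ext_flag_Times)
    show "ext.subspace (?F i)" for i by (rule F_subspace)
    show "ext.dim (?F i) = i" if "i \<le> m + 2" for i
    proof -
      consider "i = 0" | j where "i = Suc j" "j \<le> m" | "i = m + 2"
        using \<open>i \<le> m + 2\<close> by (cases i) force+
      then show ?thesis
      proof cases
        case 1
        obtain Bs' where "finite_dimensional_vector_space (ext_scale scale) Bs'"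
          using finite_dimensional_ext[OF fd] by blast
        then interpret e: finite_dimensional_vector_space "ext_scale scale" Bs' .
        show ?thesis using 1 by (simp add: ext_flag_Times)
      next
        case 2
        then show ?thesis
          using dim_ext(1)[OF fd V_subspace[of j]] V_dim[of j] by (simp add: ext_flag_Times)
      next
        case 3
        then show ?thesis
          using dim_ext(2)[OF fd V_subspace[of m]] V_dim[of m] by (simp add: ext_flag_Times)
      qed
    qed
    show "?F i \<subseteq> ?F (Suc i)" if "i < m + 2" for i
      using F_mono that .
    show "ext.span (?S i) = ?F i" if "i < m + 2" for i
    proof -
      consider "i = 0" | "1 \<le> i" "i \<le> m" | "i = Suc m"
        using \<open>i < m + 2\<close> by linarith
      then show ?thesis
      proof cases
        case 1
        then have "ext.span (?S i) \<subseteq> {0}"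
          using ext.span_minimal[OF sub F_subspace, of 0] by (simp add: ext_flag_Times)
        then show ?thesis
          using 1 ext.span_zero by (auto simp: ext_flag_Times)
      qed (use span_eq span_top in simp_all)
    qed
  qed simp
qed

end

section \<open>The symplectic filiform structure on the double extension\<close>

theorem proposition5p2:
  fixes scale :: "'k::field_char_0 \<Rightarrow> 'v::ab_group_add \<Rightarrow> 'v"
    and G :: "bit \<Rightarrow> 'v set"
    and br :: "'v \<Rightarrow> 'v \<Rightarrow> 'v"
    and B \<omega> :: "'v \<Rightarrow> 'v \<Rightarrow> 'k"
    and m :: nat and V :: "nat \<Rightarrow> 'v set"
    and e1 em X0 A1 :: 'v
    and \<delta> D :: "'v \<Rightarrow> 'v"
    and \<alpha> \<mu> :: 'k
  assumes "\<exists>Bs. finite_dimensional_vector_space scale Bs"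
    and "quadratic_symplectic_lie_superalgebra scale G br B \<omega>"
    and "filiform_lie_superalgebra scale G br m V"
    and "V 1 = module.span scale {e1}"
    and "em \<in> V m - V (m - 1)"
    and "superderivation scale G br 0 \<delta>" and "bij \<delta>" and "skew_supersymmetric_map G B 0 \<delta>"
    and "\<forall>x y. \<omega> x y = B (\<delta> x) y"
    and "superderivation scale G br 1 D" and "skew_supersymmetric_map G B 1 D"
    and "X0 \<in> G 0" and "X0 \<noteq> 0"
    and "D X0 = 0" and "B X0 X0 = 0"
    and "\<forall>x. D (D x) = scale (1/2) (br X0 x)"
    and "em \<in> D ` G 0"
    and "\<alpha> \<noteq> 0" and "A1 \<in> G 1"
    and "\<forall>x. (\<delta> (D x) - D (\<delta> x)) + scale \<alpha> (D x) = br A1 x"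
    and "D A1 = scale \<alpha> X0 + scale (1/2) (\<delta> X0)"
  defines "scale' \<equiv> ext_scale scale"
    and "G' \<equiv> ext_grading G"
    and "br' \<equiv> ext_bracket scale G br B D X0"
    and "B' \<equiv> ext_form B"
    and "\<delta>' \<equiv> ext_map scale B \<delta> \<alpha> \<mu> A1"
  shows "superderivation scale' G' br' 0 \<delta>' \<and> bij \<delta>' \<and> skew_supersymmetric_map G' B' 0 \<delta>' \<and>
    (\<exists>Bs'. finite_dimensional_vector_space scale' Bs') \<and>
    quadratic_symplectic_lie_superalgebra scale' G' br' B' (\<lambda>x y. B' (\<delta>' x) y) \<and>
    filiform_lie_superalgebra scale' G' br' (m + 2) (ext_flag m V)"
proof -
  obtain Bs where fd: "finite_dimensional_vector_space scale Bs"
    using assms(1) by blast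
  interpret S: quadratic_symplectic_lie_superalgebra scale G br B \<omega>
    by (rule assms(2))
  interpret double_extension scale G br B D X0
    by unfold_locales (use assms(10-16) in auto)
  interpret ext: quadratic_lie_superalgebra scale' G' br' B'
    unfolding scale'_def G'_def br'_def B'_def by (rule ext_quadratic)
  have lin: "Vector_Spaces.linear scale scale \<delta>"
    using assms(6) unfolding superderivation_def by blast
  have der: "superderivation scale' G' br' 0 \<delta>'"
    unfolding scale'_def G'_def br'_def \<delta>'_def
    using assms(6,8,19-21) by (intro ext_map_superderivation) blast+
  have bij: "bij \<delta>'"
    unfolding \<delta>'_def using assms(7,18) by (rule bij_ext_map)
  have skew: "skew_supersymmetric_map G' B' 0 \<delta>'"
    unfolding G'_def B'_def \<delta>'_def using lin assms(8,19) by (rule ext_map_skew)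
  have fin: "\<exists>Bs'. finite_dimensional_vector_space scale' Bs'"
    unfolding scale'_def by (rule finite_dimensional_ext[OF fd])
  \<comment> \<open>The passage from superderivations to symplectic forms is applied to the
    extension itself, already known to be quadratic.\<close>
  have symp: "quadratic_symplectic_lie_superalgebra scale' G' br' B' (\<lambda>x y. B' (\<delta>' x) y)"
    using der skew bij by (rule ext.superderivation_symplectic)
  have fil: "filiform_lie_superalgebra scale' G' br' (m + 2) (ext_flag m V)"
    unfolding scale'_def G'_def br'_def
    using assms(5,17) by (intro ext_filiform[OF fd assms(3)]) auto
  show ?thesis
    using der bij skew fin symp fil by blast
qed

end
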